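(* Let $a_h$ and $a_h^+$ be uniformly coercive and continuous bilinear forms on $\mathcal{V}\times\mathcal{V}$. Suppose there is a constant $\eta\in[2,\infty]$ such that the following three conditions hold: (i) For every $h\le h_0$, $\mathcal{V}_h,\mathcal{V}_h^+\subset W^{s,\eta}(\Omega)\cap\mathcal{V}$. (ii) There exists $C>0$ independent of $h$ such that $\|w_h\|_{m,\eta}\le Ch^{-m}\|w_h\|_{0,\eta}$ for every $m=0,1,\dots,s$, every $w_h\in\mathcal{V}_h^+\cap\mathcal{V}_h$, and every $h\le h_0$. (iii) There exist constants $\gamma\ge0$ and $C>0$ independent of $h$ and a map $\pi_h:\mathcal{V}_h^++\mathcal{V}_h\to\mathcal{V}_h^+\cap\mathcal{V}_h$ such that $\|\pi_hw_h\|_{0,\eta}\le C\|w_h\|_{0,\eta}$ and $|\mathrm{supp}(\pi_hw_h-w_h)|\le Ch^\gamma$ for every $w_h\in\mathcal{V}_h^++\mathcal{V}_h$ and every $h\le h_0$. Suppose further that there exist constants $C_1>0$, $\delta\ge0$, $1\le q\le\eta$, and $\mu,\nu\in\{0,1,\dots,s\}$ independent of $h$ such that $$|a_h^+(v,w)-a_h(v,w)|\le C_1h^\delta\|v\|_{\mu,\eta}\|w\|_{\nu,q}$$ for every $v,w\in W^{s,\eta}(\Omega)\cap\mathcal{V}$ and every $h\le h_0$. Then there exists $C>0$ independent of $h$ such that for any $h\le h_0$ and any $u\in W^{s,\eta}(\Omega)\cap\mathcal{V}$, $$ \begin{split} \|r_h^+ u - r_h u\|_{s,2} \le C h^{\sigma-s}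 \Big[ &h^s\|r_h^+ u - u\|_{s,\eta} + h^s\|r_h u - u\|_{s,\eta} + \|r_h^+ u - u\|_{0,\eta} + \|r_h u - u\|_{0,\eta} \\ &+ \left(h^\mu \|r_h u - u\|_{\mu,\eta}\right)^{1/2} \left(\|r_h^+ u - u\|_{0,\eta} + \|r_h u - u\|_{0,\eta} \right)^{1/2} \Big] \end{split} $$ with $$\sigma=\min\left\{\gamma\left(\frac12-\frac1\eta\right),\frac{\delta+2s-\mu-\nu}{2}\right\}.$$
   Context: Let $s\ge 0$ be an integer, $\Omega\subset\mathbb{R}^d$ ($d \ge 1$) an open, bounded, Lipschitz domain, and $\mathcal{V}$ a closed subspace of $H^s(\Omega)=W^{s,2}(\Omega)$ (with $H^0=L^2$). $\|\cdot\|_{s,p}$ denotes the norm of the Sobolev space $W^{s,p}(\Omega)$ (with $W^{0,p}=L^p$), and $|E|$ denotes the Lebesgue measure of a set $E$. Let $h_0>0$. For each $0<h\le h_0$, $a_h,a_h^+:\mathcal{V}\times\mathcal{V}\to\mathbb{R}$ are (not necessarily symmetric) bilinear forms. "Uniformly continuous and coercive" means there are constants $\alpha>0$ and $M>0$ independent of $h$ such that $a_h(u,u)\ge\alpha\|u\|_{s,2}^2$ and $a_h(u,w)\le M\|u\|_{s,2}\|w\|_{s,2}$ for all $u,w\in\mathcal{V}$ and all $h\le h_0$, and the same inequalities hold for $a_h^+$ with the same constants. Let $\{\mathcal{V}_h\}_{0<h\le h_0}$ and $\{\mathcal{V}_h^+\}_{0<h\le h_0}$ be two families of finite element (finite-dimensional)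 subspaces of $\mathcal{V}$. The linear projectors $r_h:\mathcal{V}\to\mathcal{V}_h$ and $r_h^+:\mathcal{V}\to\mathcal{V}_h^+$ are defined (uniquely, by Lax-Milgram) by $a_h(r_hu-u,w_h)=0$ for all $w_h\in\mathcal{V}_h$, and $a_h^+(r_h^+u-u,w_h^+)=0$ for all $w_h^+\in\mathcal{V}_h^+$. The letter $C$ denotes a constant independent of $h$, not necessarily the same at each occurrence (and, where a bound is asserted for every function in a class, independent of that function). The convention $1/\infty=0$ is used. *)

theory Defs
  imports
    "HOL-Analysis.Analysis"
    "HOL-Probability.Essential_Supremum"
    "HOL-Library.Function_Algebras"
    "HOL-Library.Set_Algebras"
    "HOL-Library.Multiset"
begin

section \<open>Lipschitz domains\<close>

text \<open>
  Near each boundary point, \<open>\<Omega>\<close> is the part of the space strictly above the graph of a Lipschitz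
  function, where \<open>n\<close> is the upward unit vector of the local coordinate system and the graph is
  taken over the hyperplane orthogonal to \<open>n\<close>.  Connectedness is not imposed.
\<close>

definition lipschitz_domain :: "'a::euclidean_space set \<Rightarrow> bool" where
  "lipschitz_domain \<Omega> \<longleftrightarrow> open \<Omega> \<and> \<Omega> \<noteq> {} \<and>
     (\<forall>x\<in>frontier \<Omega>. \<exists>r>0. \<exists>n (g :: 'a \<Rightarrow> real) L.
        norm n = 1 \<and> L-lipschitz_on {y. y \<bullet> n = 0} g \<and>
        \<Omega> \<inter> ball x r = {y \<in> ball x r. g (y - (y \<bullet> n) *\<^sub>R n) < y \<bullet> n})"


section \<open>Lebesgue and Sobolev spaces\<close>

text \<open>
  A function on \<open>\<Omega>\<close> is represented by a function on the whole space whose values outside \<open>\<Omega>\<close> are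
  irrelevant, and an element of a Lebesgue or Sobolev space by any of its representatives modulo
  equality almost everywhere in \<open>\<Omega>\<close>.  Exponents range over the extended nonnegative reals; only
  values at least 1 are meant.
\<close>

definition Lp :: "'a::euclidean_space set \<Rightarrow> ennreal \<Rightarrow> ('a \<Rightarrow> real) set" where
  "Lp \<Omega> p = {f \<in> borel_measurable (lebesgue_on \<Omega>).
     if p = \<infinity> then esssup (lebesgue_on \<Omega>) (\<lambda>x. ereal \<bar>f x\<bar>) < \<infinity>
     else integrable (lebesgue_on \<Omega>) (\<lambda>x. \<bar>f x\<bar> powr enn2real p)}"

definition Lp_norm :: "'a::euclidean_space set \<Rightarrow> ennreal \<Rightarrow> ('a \<Rightarrow> real) \<Rightarrow> real" where
  "Lp_norm \<Omega> p f =
     (if p = \<infinity> then real_of_ereal (esssup (lebesgue_on \<Omega>) (\<lambda>x. ereal \<bar>f x\<bar>))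
      else (LINT x|lebesgue_on \<Omega>. \<bar>f x\<bar> powr enn2real p) powr (1 / enn2real p))"

text \<open>
  A multi-index is a multiset of basis vectors: the multiplicity of \<open>b\<close> is the number of
  differentiations in direction \<open>b\<close>, and the order of the multi-index is its size.
\<close>

definition multi_indices :: "nat \<Rightarrow> 'a::euclidean_space multiset set" where
  "multi_indices k = {\<alpha>. set_mset \<alpha> \<subseteq> Basis \<and> size \<alpha> \<le> k}"

fun iterated_partial :: "'a list \<Rightarrow> ('a::euclidean_space \<Rightarrow> real) \<Rightarrow> 'a \<Rightarrow> real" where
  "iterated_partial [] f = f"
| "iterated_partial (b # bs) f = (\<lambda>x. frechet_derivative (iterated_partial bs f) (at x) b)"

definition smooth :: "('a::euclidean_space \<Rightarrow> real) \<Rightarrow> bool" where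
  "smooth f \<longleftrightarrow> (\<forall>bs x. set bs \<subseteq> Basis \<longrightarrow> iterated_partial bs f differentiable (at x))"

text \<open>The order of differentiation is immaterial for the smooth functions this is applied to.\<close>

definition classical_deriv :: "'a multiset \<Rightarrow> ('a::euclidean_space \<Rightarrow> real) \<Rightarrow> 'a \<Rightarrow> real" where
  "classical_deriv \<alpha> f = iterated_partial (SOME bs. mset bs = \<alpha>) f"

definition test_functions :: "'a::euclidean_space set \<Rightarrow> ('a \<Rightarrow> real) set" where
  "test_functions \<Omega> =
     {\<phi>. smooth \<phi> \<and> compact (closure {x. \<phi> x \<noteq> 0}) \<and> closure {x. \<phi> x \<noteq> 0} \<subseteq> \<Omega>}"

definition locally_integrable :: "'a::euclidean_space set \<Rightarrow> ('a \<Rightarrow> real) \<Rightarrow> bool" where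
  "locally_integrable \<Omega> f \<longleftrightarrow> (\<forall>K. compact K \<and> K \<subseteq> \<Omega> \<longrightarrow> f absolutely_integrable_on K)"

definition has_weak_deriv ::
    "'a::euclidean_space set \<Rightarrow> 'a multiset \<Rightarrow> ('a \<Rightarrow> real) \<Rightarrow> ('a \<Rightarrow> real) \<Rightarrow> bool" where
  "has_weak_deriv \<Omega> \<alpha> u g \<longleftrightarrow> locally_integrable \<Omega> u \<and> locally_integrable \<Omega> g \<and>
     (\<forall>\<phi>\<in>test_functions \<Omega>.
        (LINT x|lebesgue_on \<Omega>. u x * classical_deriv \<alpha> \<phi> x) =
        (-1) ^ size \<alpha> * (LINT x|lebesgue_on \<Omega>. g x * \<phi> x))"

definition weak_deriv ::
    "'a::euclidean_space set \<Rightarrow> 'a multiset \<Rightarrow> ('a \<Rightarrow> real) \<Rightarrow> 'a \<Rightarrow> real" where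
  "weak_deriv \<Omega> \<alpha> u = (SOME g. has_weak_deriv \<Omega> \<alpha> u g)"

definition sobolev :: "'a::euclidean_space set \<Rightarrow> nat \<Rightarrow> ennreal \<Rightarrow> ('a \<Rightarrow> real) set" where
  "sobolev \<Omega> s p =
     {u \<in> Lp \<Omega> p. \<forall>\<alpha>\<in>multi_indices s. \<exists>g\<in>Lp \<Omega> p. has_weak_deriv \<Omega> \<alpha> u g}"

definition sobolev_norm ::
    "'a::euclidean_space set \<Rightarrow> nat \<Rightarrow> ennreal \<Rightarrow> ('a \<Rightarrow> real) \<Rightarrow> real" where
  "sobolev_norm \<Omega> s p u =
     (if p = \<infinity> then (MAX \<alpha>\<in>multi_indices s. Lp_norm \<Omega> p (weak_deriv \<Omega> \<alpha> u))
      else (\<Sum>\<alpha>\<in>multi_indices s. Lp_norm \<Omega> p (weak_deriv \<Omega> \<alpha> u) powr enn2real p)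
             powr (1 / enn2real p))"

text \<open>
  The support of a class of functions: the complement in \<open>\<Omega>\<close> of the largest open set on which the
  function vanishes almost everywhere.
\<close>

definition ess_support :: "'a::euclidean_space set \<Rightarrow> ('a \<Rightarrow> real) \<Rightarrow> 'a set" where
  "ess_support \<Omega> f = \<Omega> - \<Union>{U. open U \<and> U \<subseteq> \<Omega> \<and> (AE x in lebesgue_on U. f x = 0)}"


section \<open>Subspaces and bilinear forms\<close>

global_interpretation fun_space: vector_space "\<lambda>c (u :: 'a \<Rightarrow> real) x. c * u x"
  defines fun_subspace = fun_space.subspace
    and fun_span = fun_space.span
  by standard (auto simp: algebra_simps plus_fun_def)

definition ae_eq_on :: "'a::euclidean_space set \<Rightarrow> ('a \<Rightarrow> real) \<Rightarrow> ('a \<Rightarrow> real) \<Rightarrow> bool" where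
  "ae_eq_on \<Omega> u v \<longleftrightarrow> (AE x in lebesgue_on \<Omega>. u x = v x)"

text \<open>
  The second conjunct gives closedness in the Sobolev norm; it also makes \<open>V\<close> invariant under
  changing representatives.
\<close>

definition closed_sobolev_subspace ::
    "'a::euclidean_space set \<Rightarrow> nat \<Rightarrow> ennreal \<Rightarrow> ('a \<Rightarrow> real) set \<Rightarrow> bool" where
  "closed_sobolev_subspace \<Omega> s p V \<longleftrightarrow> V \<subseteq> sobolev \<Omega> s p \<and> fun_subspace V \<and>
     (\<forall>f u. (\<forall>k. f k \<in> V) \<and> u \<in> sobolev \<Omega> s p \<and>
        (\<lambda>k. sobolev_norm \<Omega> s p (f k - u)) \<longlonglongrightarrow> 0 \<longrightarrow> u \<in> V)"

text \<open>
  Finite-dimensionality is meant modulo equality almost everywhere.  A subspace contains every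
  representative of each of its elements, so that sums and intersections of subspaces as sets of
  functions agree with those as spaces of classes.
\<close>

definition fin_dim_subspace ::
    "'a::euclidean_space set \<Rightarrow> ('a \<Rightarrow> real) set \<Rightarrow> ('a \<Rightarrow> real) set \<Rightarrow> bool" where
  "fin_dim_subspace \<Omega> V W \<longleftrightarrow> W \<subseteq> V \<and> fun_subspace W \<and>
     (\<forall>u\<in>W. \<forall>v. ae_eq_on \<Omega> u v \<longrightarrow> v \<in> W) \<and>
     (\<exists>B. finite B \<and> B \<subseteq> W \<and> (\<forall>w\<in>W. \<exists>v\<in>fun_span B. ae_eq_on \<Omega> w v))"

definition bilinear_form_on ::
    "('a \<Rightarrow> real) set \<Rightarrow> (('a \<Rightarrow> real) \<Rightarrow> ('a \<Rightarrow> real) \<Rightarrow> real) \<Rightarrow> bool" where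
  "bilinear_form_on V a \<longleftrightarrow>
     (\<forall>u\<in>V. \<forall>v\<in>V. \<forall>w\<in>V. a (u + v) w = a u w + a v w \<and> a w (u + v) = a w u + a w v) \<and>
     (\<forall>c. \<forall>u\<in>V. \<forall>w\<in>V. a (\<lambda>x. c * u x) w = c * a u w \<and> a u (\<lambda>x. c * w x) = c * a u w)"

text \<open>
  Two families of forms satisfying the coercivity and continuity bounds with common constants.
  Applied to \<open>-u\<close>, the one-sided continuity bound yields the two-sided one; hence the values of
  such forms do not depend on the choice of representatives.
\<close>

definition uniformly_continuous_coercive ::
    "'a::euclidean_space set \<Rightarrow> nat \<Rightarrow> ('a \<Rightarrow> real) set \<Rightarrow> real \<Rightarrow>
     (real \<Rightarrow> ('a \<Rightarrow> real) \<Rightarrow> ('a \<Rightarrow> real) \<Rightarrow> real) \<Rightarrow>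
     (real \<Rightarrow> ('a \<Rightarrow> real) \<Rightarrow> ('a \<Rightarrow> real) \<Rightarrow> real) \<Rightarrow> bool" where
  "uniformly_continuous_coercive \<Omega> s V h\<^sub>0 a a' \<longleftrightarrow>
     (\<exists>\<alpha>>0. \<exists>M>0. \<forall>h\<in>{0<..h\<^sub>0}. \<forall>b\<in>{a h, a' h}. \<forall>u\<in>V. \<forall>w\<in>V.
        b u u \<ge> \<alpha> * (sobolev_norm \<Omega> s 2 u)\<^sup>2 \<and>
        b u w \<le> M * sobolev_norm \<Omega> s 2 u * sobolev_norm \<Omega> s 2 w)"

text \<open>
  By Lax--Milgram, these conditions determine \<open>r u\<close> uniquely up to equality almost everywhere;
  linearity of \<open>r\<close> on classes follows.
\<close>

definition galerkin_projector ::
    "('a \<Rightarrow> real) set \<Rightarrow> ('a \<Rightarrow> real) set \<Rightarrow> (('a \<Rightarrow> real) \<Rightarrow> ('a \<Rightarrow> real) \<Rightarrow> real) \<Rightarrow>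
     (('a \<Rightarrow> real) \<Rightarrow> 'a \<Rightarrow> real) \<Rightarrow> bool" where
  "galerkin_projector V W a r \<longleftrightarrow> (\<forall>u\<in>V. r u \<in> W \<and> (\<forall>w\<in>W. a (r u - u) w = 0))"

end

theory Submission
  imports Defs
begin

text \<open>
  Write \<open>e = r' u - r u\<close> and \<open>z = \<pi> e\<close>.  Coercivity bounds \<open>e\<close> by
  \<open>a' e e = a' e (e - z) + a' e z\<close>.  The first term is small because \<open>e - z\<close> and all its weak
  derivatives vanish outside a set of measure \<open>O(h powr \<gamma>)\<close>, so that Hoelder's inequality gains the
  factor \<open>h powr (\<gamma> (1/2 - 1/\<eta>))\<close>; the inverse estimate controls \<open>z\<close>.  In the second, Galerkin
  orthogonality for both projections turns \<open>a' e z\<close> into \<open>- (a' - a) (r u - u) z\<close>, which the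
  consistency bound estimates.  The resulting quadratic inequality for the norm of \<open>e\<close> yields the
  square root in the bound.
\<close>

section \<open>Smooth approximations of indicators of boxes\<close>

text \<open>\<open>weak_deriv\<close> is a \<open>SOME\<close> choice, so
  \<open>sobolev_norm\<close> cannot be handled until weak derivatives are known to be unique almost
  everywhere. Uniqueness rests on the fundamental lemma of the calculus of variations, which needs a
  supply of test functions; hence the explicit smooth bumps. A localised form of that lemma shows
  that weak derivatives vanish off the essential support, which is what makes a support of small
  measure usable in a norm with derivatives. The map \<open>\<pi>\<close> is stable in order 0 only.
  Higher orders of \<open>z\<close> are reached through the inverse estimate, at the price of a
  negative power of \<open>h\<close>, and this is why errors of order 0 stand in the bound without a
  power of \<open>h\<close> of their own. The second entry of \<open>\<sigma>\<close> is an exponent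
  under a square root: consistency gives \<open>\<delta>\<close>, the inverse estimate for
  \<open>z\<close> in order \<open>\<nu>\<close> costs \<open>\<nu>\<close>, and
  \<open>\<mu>\<close> is handed over to the error of order \<open>\<mu>\<close>; half of what
  remains is the exponent. Only a bound up to a constant is claimed, so crude triangle inequalities
  suffice; and since \<open>h\<close> may exceed 1, powers of \<open>h\<^sub>0\<close> enter that
  constant.\<close>

text \<open>The family in \<open>k\<close> is closed under differentiation up to linear combinations.\<close>

definition bump_atom :: "nat \<Rightarrow> real \<Rightarrow> real" where
  "bump_atom k t = (if t > 0 then exp (- (1 / t)) / t ^ k else 0)"

text \<open>With \<open>inverse t\<close> as the variable this is the decay of a power against the
  exponential.\<close>

lemma tendsto_bump_atom_at_right_0: "(bump_atom k \<longlongrightarrow> 0) (at_right 0)"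
proof -
  have "((\<lambda>t::real. inverse t ^ k / exp (inverse t)) \<longlongrightarrow> 0) (at_right 0)"
    by (rule filterlim_compose[OF tendsto_power_div_exp_0 filterlim_inverse_at_top_right])
  moreover have "eventually (\<lambda>t. inverse t ^ k / exp (inverse t) = bump_atom k t) (at_right (0::real))"
    using eventually_at_right_less[of 0]
    by eventually_elim (simp add: bump_atom_def exp_minus field_simps)
  ultimately show ?thesis by (rule Lim_transform_eventually)
qed

lemma tendsto_bump_atom_at_0: "(bump_atom k \<longlongrightarrow> 0) (at 0)"
proof -
  have "eventually (\<lambda>t. 0 = bump_atom k t) (at_left (0::real))"
    by (auto simp: eventually_at_filter bump_atom_def)
  then have "(bump_atom k \<longlongrightarrow> 0) (at_left 0)"
    by (rule Lim_transform_eventually[OF tendsto_const])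
  then show ?thesis
    using tendsto_bump_atom_at_right_0 filterlim_split_at by blast
qed

lemma bump_atom_has_real_derivative:
  "(bump_atom k has_real_derivative bump_atom (k + 2) t - real k * bump_atom (k + 1) t) (at t)"
proof -
  consider "t > 0" | "t < 0" | "t = 0" by linarith
  then show ?thesis
  proof cases
    case 1
    have "((\<lambda>t. exp (- (1 / t)) / t ^ k) has_real_derivative
        bump_atom (k + 2) t - real k * bump_atom (k + 1) t) (at t)"
    proof (cases k)
      case 0
      then show ?thesis using 1
        by (auto intro!: derivative_eq_intros simp: bump_atom_def power2_eq_square)
    next
      case (Suc j)
      moreover have "j = 0 \<or> t * t ^ (j - 1) = t ^ j"
        by (cases j) auto
      ultimately show ?thesis using 1
        by (auto intro!: derivative_eq_intros simp: bump_atom_def field_simps power2_eq_square)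
    qed
    then show ?thesis
      by (rule has_field_derivative_transform_within_open[of _ _ _ "{0<..}"])
        (use 1 in \<open>auto simp: bump_atom_def\<close>)
  next
    case 2
    have "((\<lambda>t. 0) has_real_derivative bump_atom (k + 2) t - real k * bump_atom (k + 1) t) (at t)"
      using 2 by (auto simp: bump_atom_def)
    then show ?thesis
      by (rule has_field_derivative_transform_within_open[of _ _ _ "{..<0}"])
        (use 2 in \<open>auto simp: bump_atom_def\<close>)
  next
    case 3
    \<comment> \<open>The difference quotient of \<open>bump_atom k\<close> at 0 is
      \<open>bump_atom (k + 1)\<close> itself, because \<open>bump_atom k 0\<close> is 0; the limit
      at 0, known for every index, therefore is the derivative.\<close>
    have "(bump_atom (k + 1) \<longlongrightarrow> 0) (at 0)" by (rule tendsto_bump_atom_at_0)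
    moreover have "bump_atom (k + 1) = (\<lambda>t. (bump_atom k (0 + t) - bump_atom k 0) / t)"
      by (auto simp: bump_atom_def)
    ultimately have "(bump_atom k has_real_derivative 0) (at 0)"
      by (simp only: DERIV_def)
    with 3 show ?thesis by (simp add: bump_atom_def)
  qed
qed

text \<open>\<open>smooth\<close> quantifies over all iterated partial derivatives. A set that
  contains the bumps and is stable under partial derivatives reduces smoothness to an induction over
  the list of directions. Constants supply the coefficients that the chain rule produces.\<close>

inductive_set bump_algebra :: "('a::euclidean_space \<Rightarrow> real) set" where
  const: "(\<lambda>x. c) \<in> bump_algebra"
| atom: "(\<lambda>x. bump_atom k (c * (x \<bullet> b) + d)) \<in> bump_algebra"
| add: "f \<in> bump_algebra \<Longrightarrow> g \<in> bump_algebra \<Longrightarrow> (\<lambda>x. f x + g x) \<in> bump_algebra"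
| mult: "f \<in> bump_algebra \<Longrightarrow> g \<in> bump_algebra \<Longrightarrow> (\<lambda>x. f x * g x) \<in> bump_algebra"

lemma bump_algebra_derivative:
  "f \<in> bump_algebra \<Longrightarrow>
     \<exists>f'. (\<forall>x. (f has_derivative f' x) (at x)) \<and> (\<forall>b. (\<lambda>x. f' x b) \<in> bump_algebra)"
proof (induction rule: bump_algebra.induct)
  case (const c)
  show ?case
    by (rule exI[of _ "\<lambda>x y. 0"]) (auto intro: bump_algebra.const)
next
  case (atom k c b d)
  let ?D = "\<lambda>x. bump_atom (k + 2) (c * (x \<bullet> b) + d) - real k * bump_atom (k + 1) (c * (x \<bullet> b) + d)"
  have "((\<lambda>x. bump_atom k (c * (x \<bullet> b) + d)) has_derivative (\<lambda>y. ?D x * (c * (y \<bullet> b)))) (at x)" for x :: 'a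
  proof -
    have "((\<lambda>x. c * (x \<bullet> b) + d) has_derivative (\<lambda>y. c * (y \<bullet> b))) (at x)"
      by (auto intro!: derivative_eq_intros)
    moreover have "(bump_atom k has_derivative (\<lambda>y. ?D x * y)) (at (c * (x \<bullet> b) + d))"
      using bump_atom_has_real_derivative by (simp add: has_field_derivative_def)
    ultimately show ?thesis
      using has_derivative_compose by blast
  qed
  moreover have "(\<lambda>x. ?D x * (c * (y \<bullet> b))) \<in> bump_algebra" for y
  proof -
    have "(\<lambda>x. (bump_atom (k + 2) (c * (x \<bullet> b) + d) + (- real k) * bump_atom (k + 1) (c * (x \<bullet> b) + d))
        * (c * (y \<bullet> b))) \<in> bump_algebra"
      by (intro bump_algebra.intros)
    then show ?thesis by simp
  qed
  ultimately show ?case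
    by (intro exI[of _ "\<lambda>x y. ?D x * (c * (y \<bullet> b))"]) auto
next
  case (add f g)
  then obtain f' g' where
    "\<And>x. (f has_derivative f' x) (at x)" "\<And>b. (\<lambda>x. f' x b) \<in> bump_algebra"
    "\<And>x. (g has_derivative g' x) (at x)" "\<And>b. (\<lambda>x. g' x b) \<in> bump_algebra" by blast
  then show ?case
    by (intro exI[of _ "\<lambda>x y. f' x y + g' x y"]) (auto intro: has_derivative_add bump_algebra.add)
next
  case (mult f g)
  then obtain f' g' where
    "\<And>x. (f has_derivative f' x) (at x)" "\<And>b. (\<lambda>x. f' x b) \<in> bump_algebra"
    "\<And>x. (g has_derivative g' x) (at x)" "\<And>b. (\<lambda>x. g' x b) \<in> bump_algebra" by blast
  with mult.hyps show ?case
    by (intro exI[of _ "\<lambda>x y. f x * g' x y + f' x y * g x"])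
      (auto intro!: has_derivative_mult bump_algebra.add bump_algebra.mult)
qed

lemma bump_algebra_smooth:
  assumes "f \<in> bump_algebra"
  shows "smooth f"
proof -
  have "iterated_partial bs f \<in> bump_algebra" for bs
  proof (induction bs)
    case (Cons b bs)
    obtain f' where f': "\<And>x. (iterated_partial bs f has_derivative f' x) (at x)"
      "\<And>b. (\<lambda>x. f' x b) \<in> bump_algebra"
      using bump_algebra_derivative[OF Cons] by blast
    have "frechet_derivative (iterated_partial bs f) (at x) = f' x" for x
      using frechet_derivative_at f'(1) by metis
    then show ?case using f'(2) by simp
  qed (use assms in simp)
  then show ?thesis
    unfolding smooth_def using bump_algebra_derivative differentiable_def by blast
qed

section \<open>Smooth bumps supported in a box\<close>

lemma bump_algebra_prod:
  assumes "finite A" "\<And>i. i \<in> A \<Longrightarrow> f i \<in> bump_algebra"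
  shows "(\<lambda>x. \<Prod>i\<in>A. f i x) \<in> bump_algebra"
  using assms
proof (induction rule: finite_induct)
  case empty
  show ?case by (simp add: bump_algebra.const)
qed (auto intro: bump_algebra.mult)

text \<open>Each factor depends on the signed distance of a coordinate to a face: it is 0 on the
  wrong side and tends to 1 on the right side as \<open>n\<close> grows. The products stay below 1
  and approximate the indicator of the open box. \<open>Suc n\<close> keeps the scale positive at
  \<open>n = 0\<close>.\<close>

definition box_bump :: "'a::euclidean_space \<Rightarrow> 'a \<Rightarrow> nat \<Rightarrow> 'a \<Rightarrow> real" where
  "box_bump a b n x =
     (\<Prod>i\<in>Basis. bump_atom 0 (real (Suc n) * (x \<bullet> i - a \<bullet> i)) * bump_atom 0 (real (Suc n) * (b \<bullet> i - x \<bullet> i)))"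

lemma bump_atom_0_bounds: "0 \<le> bump_atom 0 t" "bump_atom 0 t \<le> 1"
  by (auto simp: bump_atom_def)

lemma box_bump_bounds: "0 \<le> box_bump a b n x" "box_bump a b n x \<le> 1"
  unfolding box_bump_def
  by (auto intro!: prod_nonneg prod_le_1 mult_le_one bump_atom_0_bounds mult_nonneg_nonneg)

lemma box_bump_support: "x \<notin> box a b \<Longrightarrow> box_bump a b n x = 0"
  by (force simp: box_bump_def box_def bump_atom_def not_less zero_less_mult_iff)

lemma box_bump_smooth: "smooth (box_bump a b n)"
proof -
  have "(\<lambda>x. \<Prod>i\<in>Basis. bump_atom 0 (real (Suc n) * (x \<bullet> i) + (- real (Suc n) * (a \<bullet> i)))
      * bump_atom 0 ((- real (Suc n)) * (x \<bullet> i) + real (Suc n) * (b \<bullet> i))) \<in> bump_algebra"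
    by (intro bump_algebra_prod bump_algebra.mult bump_algebra.atom) auto
  moreover have "box_bump a b n = (\<lambda>x. \<Prod>i\<in>Basis. bump_atom 0 (real (Suc n) * (x \<bullet> i) + (- real (Suc n) * (a \<bullet> i)))
      * bump_atom 0 ((- real (Suc n)) * (x \<bullet> i) + real (Suc n) * (b \<bullet> i)))"
    by (rule ext) (simp add: box_bump_def algebra_simps)
  ultimately show ?thesis by (simp only: bump_algebra_smooth)
qed

lemma box_bump_test_function:
  assumes "cbox a b \<subseteq> \<Omega>"
  shows "box_bump a b n \<in> test_functions \<Omega>"
proof -
  have "{x. box_bump a b n x \<noteq> 0} \<subseteq> cbox a b"
    using box_bump_support box_subset_cbox by blast
  then have *: "closure {x. box_bump a b n x \<noteq> 0} \<subseteq> cbox a b"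
    by (rule closure_minimal) auto
  then have "compact (closure {x. box_bump a b n x \<noteq> 0})"
    by (metis closed_closure compact_Int_closed compact_cbox inf.absorb_iff2)
  with * assms show ?thesis
    by (auto simp: test_functions_def box_bump_smooth)
qed

lemma tendsto_bump_atom_0_scaled:
  assumes "t > 0"
  shows "(\<lambda>n. bump_atom 0 (real (Suc n) * t)) \<longlonglongrightarrow> 1"
proof -
  have "(\<lambda>n. exp (- (1 / t * inverse (real (Suc n))))) \<longlonglongrightarrow> exp (- (1 / t * 0))"
    by (intro tendsto_intros LIMSEQ_inverse_real_of_nat)
  moreover have "bump_atom 0 (real (Suc n) * t) = exp (- (1 / t * inverse (real (Suc n))))" for n
    using assms zero_less_mult_iff[of "real (Suc n)" t]
    by (simp add: bump_atom_def inverse_eq_divide mult.commute del: of_nat_Suc)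
  ultimately show ?thesis by simp
qed

lemma box_bump_tendsto: "(\<lambda>n. box_bump a b n x) \<longlonglongrightarrow> indicator (box a b) x"
proof (cases "x \<in> box a b")
  case True
  then have "(\<lambda>n. box_bump a b n x) \<longlonglongrightarrow> (\<Prod>i\<in>(Basis::'a set). 1 * 1)"
    unfolding box_bump_def
    by (intro tendsto_prod tendsto_mult tendsto_bump_atom_0_scaled) (auto simp: box_def)
  with True show ?thesis by simp
qed (simp add: box_bump_support)


section \<open>The fundamental lemma of the calculus of variations\<close>

lemma AE_lebesgue_on_iff:
  "U \<in> sets lebesgue \<Longrightarrow> (AE x in lebesgue_on U. P x) \<longleftrightarrow> (AE x in lebesgue. x \<in> U \<longrightarrow> P x)"
  by (rule AE_restrict_space_iff) simp

lemma smooth_continuous: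
  assumes "smooth f"
  shows "continuous_on UNIV f"
proof -
  have "iterated_partial [] f differentiable (at x)" for x
    using assms unfolding smooth_def by (metis empty_set empty_subsetI)
  then show ?thesis
    by (simp add: continuous_on_eq_continuous_at differentiable_imp_continuous_within)
qed

lemma continuous_measurable_lebesgue:
  fixes f :: "'a::euclidean_space \<Rightarrow> real"
  assumes "continuous_on UNIV f"
  shows "f \<in> borel_measurable lebesgue"
  using borel_measurable_continuous_onI[OF assms] by (simp add: measurable_completion)

text \<open>Dominated convergence along \<open>box_bump a b n\<close>, with the absolute value of
  \<open>g\<close> restricted to the closed box as majorant. The limit is an integral over the open
  box, which agrees with the one over the closed box.\<close>

lemma integral_cbox_eq_0_if_test_orthogonal:
  fixes g :: "'a::euclidean_space \<Rightarrow> real"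
  assumes "open \<Omega>" and g: "locally_integrable \<Omega> g" and "U \<subseteq> \<Omega>" and "cbox a b \<subseteq> U"
    and orth: "\<And>\<phi>. \<phi> \<in> test_functions U \<Longrightarrow> (LINT x|lebesgue_on \<Omega>. g x * \<phi> x) = 0"
  shows "integral (cbox a b) g = 0"
proof -
  have int: "set_integrable lebesgue (cbox a b) g"
    using g[unfolded locally_integrable_def] compact_cbox[of a b] order_trans[OF assms(4,3)] by simp
  have "(\<lambda>n. LINT x|lebesgue. (indicator (cbox a b) x * g x) * box_bump a b n x)
      \<longlonglongrightarrow> (LINT x|lebesgue. (indicator (cbox a b) x * g x) * indicator (box a b) x)"
  proof (rule integral_dominated_convergence[where w = "\<lambda>x. norm (indicator (cbox a b) x * g x)"])
    have m: "(\<lambda>x. indicator (cbox a b) x * g x) \<in> borel_measurable lebesgue"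
      using int unfolding set_integrable_def by (simp add: borel_measurable_integrable)
    show "integrable lebesgue (\<lambda>x. norm (indicator (cbox a b) x * g x))"
      using int unfolding set_integrable_def by (intro integrable_norm) simp
    show "(\<lambda>x. indicator (cbox a b) x * g x * indicator (box a b) x) \<in> borel_measurable lebesgue"
      by (rule borel_measurable_times[OF m borel_measurable_indicator]) (simp add: fmeasurableD)
    show "(\<lambda>x. indicator (cbox a b) x * g x * box_bump a b n x) \<in> borel_measurable lebesgue" for n
      by (rule borel_measurable_times[OF m continuous_measurable_lebesgue[OF smooth_continuous[OF box_bump_smooth]]])
    show "AE x in lebesgue. (\<lambda>n. indicator (cbox a b) x * g x * box_bump a b n x)
        \<longlonglongrightarrow> indicator (cbox a b) x * g x * indicator (box a b) x"
      by (intro AE_I2 tendsto_mult_left box_bump_tendsto)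
    show "AE x in lebesgue. norm (indicator (cbox a b) x * g x * box_bump a b n x)
        \<le> norm (indicator (cbox a b) x * g x)" for n
      by (intro AE_I2) (simp add: abs_mult box_bump_bounds mult_left_le)
  qed
  moreover have "(LINT x|lebesgue. (indicator (cbox a b) x * g x) * box_bump a b n x) = 0" for n
  proof -
    have eq: "indicator (cbox a b) x * g x * box_bump a b n x = indicator \<Omega> x *\<^sub>R (g x * box_bump a b n x)" for x
    proof (cases "x \<in> box a b")
      case True
      then have "x \<in> cbox a b" "x \<in> \<Omega>" using box_subset_cbox[of a b] assms(3,4) by blast+
      then show ?thesis by simp
    qed (simp add: box_bump_support)
    have "(LINT x|lebesgue. (indicator (cbox a b) x * g x) * box_bump a b n x)
        = (LINT x|lebesgue. indicator \<Omega> x *\<^sub>R (g x * box_bump a b n x))"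
      by (simp only: eq)
    also have "\<dots> = (LINT x|lebesgue_on \<Omega>. g x * box_bump a b n x)"
      by (rule integral_restrict_space[symmetric]) (use \<open>open \<Omega>\<close> in simp)
    finally have "(LINT x|lebesgue. (indicator (cbox a b) x * g x) * box_bump a b n x)
        = (LINT x|lebesgue_on \<Omega>. g x * box_bump a b n x)" .
    then show ?thesis
      using orth[OF box_bump_test_function[OF assms(4)]] by simp
  qed
  ultimately have "(LINT x|lebesgue. (indicator (cbox a b) x * g x) * indicator (box a b) x) = 0"
    by (simp add: LIMSEQ_const_iff)
  moreover have "(indicator (cbox a b) x * g x) * indicator (box a b) x = indicator (box a b) x *\<^sub>R g x" for x
    using subsetD[OF box_subset_cbox[of a b], of x] by (cases "x \<in> box a b") simp_all
  ultimately have "set_lebesgue_integral lebesgue (box a b) g = 0"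
    by (simp add: set_lebesgue_integral_def)
  moreover have "set_integrable lebesgue (box a b) g"
    using int by (rule set_integrable_subset) (auto simp: box_subset_cbox)
  ultimately show ?thesis
    by (simp add: set_lebesgue_integral_eq_integral(2) integral_open_interval)
qed

text \<open>The lower corner sits at \<open>x\<close> because the differentiation theorem used next
  averages over such cubes; hence only the distances to the upper faces restrict the side.\<close>

lemma cbox_cube_subset_box:
  fixes x :: "'a::euclidean_space"
  assumes "x \<in> box c d"
  obtains r where "r > 0" "\<And>h. 0 < h \<Longrightarrow> h < r \<Longrightarrow> cbox x (x + h *\<^sub>R One) \<subseteq> box c d"
proof -
  define r where "r = Min ((\<lambda>i. d \<bullet> i - x \<bullet> i) ` Basis)"
  have r: "r > 0" "\<And>i. i \<in> Basis \<Longrightarrow> r \<le> d \<bullet> i - x \<bullet> i"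
    using assms by (auto simp: r_def box_def)
  have "cbox x (x + h *\<^sub>R One) \<subseteq> box c d" if h: "0 < h" "h < r" for h
  proof
    fix y assume y: "y \<in> cbox x (x + h *\<^sub>R One)"
    have "c \<bullet> i < y \<bullet> i \<and> y \<bullet> i < d \<bullet> i" if "i \<in> Basis" for i
    proof -
      have "x \<bullet> i \<le> y \<bullet> i" "y \<bullet> i \<le> x \<bullet> i + h"
        using y that by (simp_all add: mem_box inner_add_left)
      moreover have "c \<bullet> i < x \<bullet> i"
        using assms that by (simp add: mem_box)
      ultimately show ?thesis
        using r(2)[OF that] h by linarith
    qed
    then show "y \<in> box c d" by (simp add: mem_box)
  qed
  with r(1) show thesis using that by blast
qed

text \<open>By Lebesgue differentiation the averages of \<open>g\<close> over small cubes converge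
  to \<open>g x\<close> almost everywhere, and all of them are 0. Test functions range over
  \<open>U\<close> only while the pairing stays over \<open>\<Omega>\<close>: this is the form that
  locality of weak derivatives needs.\<close>

lemma fundamental_lemma_variations:
  fixes g :: "'a::euclidean_space \<Rightarrow> real"
  assumes "open \<Omega>" and g: "locally_integrable \<Omega> g" and "open U" and "U \<subseteq> \<Omega>"
    and orth: "\<And>\<phi>. \<phi> \<in> test_functions U \<Longrightarrow> (LINT x|lebesgue_on \<Omega>. g x * \<phi> x) = 0"
  shows "AE x in lebesgue_on U. g x = 0"
proof -
  have box: "negligible {x \<in> box c d. g x \<noteq> 0}" if cd: "cbox c d \<subseteq> U" for c d
  proof -
    \<comment> \<open>Extension by zero gives a function integrable on every box, as the
      differentiation theorem demands; cubes inside \<open>cbox c d\<close> do not notice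
      it.\<close>
    define f where "f = (\<lambda>x. if x \<in> cbox c d then g x else 0)"
    have "g absolutely_integrable_on cbox c d"
      using g[unfolded locally_integrable_def] compact_cbox[of c d] order_trans[OF cd \<open>U \<subseteq> \<Omega>\<close>] by simp
    then have "g integrable_on cbox c d"
      using absolutely_integrable_on_def by blast
    then have "f integrable_on UNIV"
      by (simp add: f_def integrable_restrict_UNIV)
    then have int: "f integrable_on cbox a b" for a b
      by (rule integrable_on_subcbox) simp
    obtain N where N: "negligible N"
      and lim: "\<And>x e. \<lbrakk>x \<notin> N; 0 < e\<rbrakk> \<Longrightarrow> \<exists>r>0. \<forall>h. 0 < h \<and> h < r \<longrightarrow>
          norm (integral (cbox x (x + h *\<^sub>R One)) f /\<^sub>R h ^ DIM('a) - f x) < e"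
      by (rule integrable_ccontinuous_explicit[OF int]) (rule that)
    have "g x = 0" if x: "x \<in> box c d" "x \<notin> N" for x
    proof (rule ccontr)
      assume "g x \<noteq> 0"
      \<comment> \<open>The tolerance is the absolute value of \<open>g x\<close>: a zero average
        misses \<open>g x\<close> by exactly that much, against the strict inequality.\<close>
      then have "\<bar>g x\<bar> > 0" by simp
      then obtain r where r: "r > 0" "\<And>h. 0 < h \<Longrightarrow> h < r \<Longrightarrow>
          norm (integral (cbox x (x + h *\<^sub>R One)) f /\<^sub>R h ^ DIM('a) - f x) < \<bar>g x\<bar>"
        using lim[OF x(2), of "\<bar>g x\<bar>"] by auto
      obtain r' where r': "r' > 0" "\<And>h. 0 < h \<Longrightarrow> h < r' \<Longrightarrow> cbox x (x + h *\<^sub>R One) \<subseteq> box c d"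
        using cbox_cube_subset_box[OF x(1)] by blast
      define h where "h = min r r' / 2"
      have h: "0 < h" "h < r" "h < r'" using r(1) r'(1) by (auto simp: h_def)
      have sub: "cbox x (x + h *\<^sub>R One) \<subseteq> cbox c d"
        using r'(2)[OF h(1,3)] box_subset_cbox by blast
      have "integral (cbox x (x + h *\<^sub>R One)) f = integral (cbox x (x + h *\<^sub>R One)) g"
        by (rule Henstock_Kurzweil_Integration.integral_cong) (use sub in \<open>auto simp: f_def\<close>)
      also have "\<dots> = 0"
        by (rule integral_cbox_eq_0_if_test_orthogonal[OF \<open>open \<Omega>\<close> g \<open>U \<subseteq> \<Omega>\<close> _ orth]) (use sub cd in blast)
      finally have "\<bar>f x\<bar> < \<bar>g x\<bar>"
        using r(2)[OF h(1,2)] by simp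
      then show False
        using x(1) subsetD[OF box_subset_cbox[of c d], of x] by (simp add: f_def)
    qed
    then have "{x \<in> box c d. g x \<noteq> 0} \<subseteq> N" by blast
    with N show ?thesis by (rule negligible_subset)
  qed
  \<comment> \<open>Countability lets the null sets add up. The members are closed boxes, and their
    boundaries, which the fact \<open>box\<close> leaves out, are negligible.\<close>
  obtain D where D: "countable D" "D \<subseteq> Pow U" "\<And>X. X \<in> D \<Longrightarrow> \<exists>a b. X = cbox a b" "\<Union>D = U"
    by (rule open_countable_Union_open_cbox[OF \<open>open U\<close>]) blast
  have "negligible (\<Union>((\<lambda>X. {x \<in> X. g x \<noteq> 0}) ` D))"
  proof (rule negligible_countable_Union)
    fix S assume "S \<in> (\<lambda>X. {x \<in> X. g x \<noteq> 0}) ` D"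
    then obtain c d where S: "S = {x \<in> cbox c d. g x \<noteq> 0}" "cbox c d \<subseteq> U"
      using D(2,3) by blast
    have "S \<subseteq> {x \<in> box c d. g x \<noteq> 0} \<union> (cbox c d - box c d)"
      using S by blast
    then show "negligible S"
      using negligible_subset[OF negligible_Un[OF box[OF S(2)] negligible_frontier_interval]] by simp
  qed (use D(1) in auto)
  then have "negligible {x \<in> U. g x \<noteq> 0}"
    by (rule negligible_subset) (use D(4) in blast)
  then have "AE x in lebesgue. x \<notin> {x \<in> U. g x \<noteq> 0}"
    by (intro AE_not_in) (simp add: negligible_iff_null_sets)
  then show ?thesis
    using \<open>open U\<close> by (subst AE_lebesgue_on_iff) auto
qed


section \<open>Weak derivatives\<close>

text \<open>Off the closed support the function vanishes on a whole neighbourhood, and so do its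
  derivatives; the induction generalises over \<open>x\<close> because differentiation looks at
  nearby points.\<close>

lemma iterated_partial_eq_0:
  assumes "x \<notin> closure {x. \<phi> x \<noteq> 0}"
  shows "iterated_partial bs \<phi> x = 0"
  using assms
proof (induction bs arbitrary: x)
  case Nil
  then show ?case using closure_subset[of "{x. \<phi> x \<noteq> 0}"] by auto
next
  case (Cons b bs)
  have "((\<lambda>x. 0) has_derivative (\<lambda>x. 0)) (at x)" by simp
  then have "(iterated_partial bs \<phi> has_derivative (\<lambda>x. 0)) (at x)"
  proof (rule has_derivative_transform_within_open)
    show "open (- closure {x. \<phi> x \<noteq> 0})" by (rule open_Compl[OF closed_closure])
    show "x \<in> - closure {x. \<phi> x \<noteq> 0}" using Cons.prems by simp
    show "0 = iterated_partial bs \<phi> y" if "y \<in> - closure {x. \<phi> x \<noteq> 0}" for y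
      using Cons.IH[of y] that by simp
  qed
  from frechet_derivative_at[OF this, symmetric] show ?case
    by simp
qed

lemma classical_deriv_eq_0:
  "x \<notin> closure {x. \<phi> x \<noteq> 0} \<Longrightarrow> classical_deriv \<alpha> \<phi> x = 0"
  unfolding classical_deriv_def by (rule iterated_partial_eq_0)

lemma classical_deriv_continuous:
  assumes "smooth \<phi>" and "set_mset \<alpha> \<subseteq> Basis"
  shows "continuous_on UNIV (classical_deriv \<alpha> \<phi>)"
proof -
  \<comment> \<open>The list picked by \<open>SOME\<close> is unknown, but its entries are those of
    \<open>\<alpha>\<close>, hence basis vectors; \<open>smooth\<close> asks for nothing
    more.\<close>
  have "mset (SOME bs. mset bs = \<alpha>) = \<alpha>"
    using ex_mset by (rule someI_ex)
  then have "set (SOME bs. mset bs = \<alpha>) \<subseteq> Basis"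
    using assms(2) by (metis set_mset_mset)
  then have "classical_deriv \<alpha> \<phi> differentiable (at x)" for x
    using assms(1) unfolding smooth_def classical_deriv_def by simp
  then show ?thesis
    by (simp add: continuous_on_eq_continuous_at differentiable_imp_continuous_within)
qed

lemma locally_integrable_times_continuous:
  assumes "open \<Omega>" and u: "locally_integrable \<Omega> u" and "compact K" and "K \<subseteq> \<Omega>"
    and \<psi>: "continuous_on UNIV \<psi>" and zero: "\<And>x. x \<notin> K \<Longrightarrow> \<psi> x = 0"
  shows "integrable (lebesgue_on \<Omega>) (\<lambda>x. u x * \<psi> x)"
proof -
  have int: "u absolutely_integrable_on K"
    using u[unfolded locally_integrable_def] assms(3,4) by simp
  have bdd: "bounded (\<psi> ` K)"
    by (rule compact_imp_bounded, rule compact_continuous_image)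
      (use \<psi> \<open>compact K\<close> continuous_on_subset in auto)
  have meas: "\<psi> \<in> borel_measurable (lebesgue_on K)"
    using measurable_restrict_space1[OF continuous_measurable_lebesgue[OF \<psi>]] .
  have K: "K \<in> sets lebesgue"
    using \<open>compact K\<close> by (simp add: fmeasurableD lmeasurable_compact)
  have "(\<lambda>x. \<psi> x * u x) absolutely_integrable_on K"
    by (rule absolutely_integrable_bounded_measurable_product[OF bilinear_times meas K bdd int])
  then have "integrable lebesgue (\<lambda>x. indicator K x *\<^sub>R (\<psi> x * u x))"
    by (simp add: set_integrable_def)
  moreover have "indicator K x *\<^sub>R (\<psi> x * u x) = indicator \<Omega> x *\<^sub>R (u x * \<psi> x)" for x
    using zero[of x] subsetD[OF \<open>K \<subseteq> \<Omega>\<close>, of x] by (cases "x \<in> K") simp_all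
  ultimately have "integrable lebesgue (\<lambda>x. indicator \<Omega> x *\<^sub>R (u x * \<psi> x))"
    by (simp only:)
  then show ?thesis
    using \<open>open \<Omega>\<close> by (subst integrable_restrict_space) simp_all
qed

text \<open>The Bochner integral of a nonintegrable function is 0, so the identities defining two
  weak derivatives can be subtracted only once each pairing is known to be integrable.\<close>

lemma integrable_times_test_deriv:
  assumes "open \<Omega>" and "locally_integrable \<Omega> u" and "\<phi> \<in> test_functions \<Omega>"
    and "set_mset \<alpha> \<subseteq> Basis"
  shows "integrable (lebesgue_on \<Omega>) (\<lambda>x. u x * classical_deriv \<alpha> \<phi> x)"
    and "integrable (lebesgue_on \<Omega>) (\<lambda>x. u x * \<phi> x)"
proof -
  let ?K = "closure {x. \<phi> x \<noteq> 0}"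
  have \<phi>: "smooth \<phi>" "compact ?K" "?K \<subseteq> \<Omega>"
    using assms(3) by (simp_all add: test_functions_def)
  show "integrable (lebesgue_on \<Omega>) (\<lambda>x. u x * classical_deriv \<alpha> \<phi> x)"
    by (rule locally_integrable_times_continuous[OF assms(1,2) \<phi>(2,3)
          classical_deriv_continuous[OF \<phi>(1) assms(4)] classical_deriv_eq_0])
  have zero: "\<phi> x = 0" if "x \<notin> ?K" for x
    using iterated_partial_eq_0[OF that, of "[]"] by simp
  show "integrable (lebesgue_on \<Omega>) (\<lambda>x. u x * \<phi> x)"
    by (rule locally_integrable_times_continuous[OF assms(1,2) \<phi>(2,3) smooth_continuous[OF \<phi>(1)] zero])
qed

section \<open>Differences, locality and uniqueness of weak derivatives\<close>

lemma locally_integrable_diff: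
  "locally_integrable \<Omega> u \<Longrightarrow> locally_integrable \<Omega> v \<Longrightarrow> locally_integrable \<Omega> (u - v)"
  by (simp add: locally_integrable_def fun_diff_def set_integral_diff(1))

lemma has_weak_deriv_diff:
  assumes "open \<Omega>" and "set_mset \<alpha> \<subseteq> Basis"
    and "has_weak_deriv \<Omega> \<alpha> u f" and "has_weak_deriv \<Omega> \<alpha> v g"
  shows "has_weak_deriv \<Omega> \<alpha> (u - v) (f - g)"
  using assms integrable_times_test_deriv[OF assms(1) _ _ assms(2)]
  by (simp add: has_weak_deriv_def locally_integrable_diff left_diff_distrib right_diff_distrib)

text \<open>Test functions supported where \<open>u\<close> vanishes cannot see \<open>u\<close>, hence neither its derivative.\<close>

lemma weak_deriv_vanishes:
  assumes "open \<Omega>" and "set_mset \<alpha> \<subseteq> Basis" and g: "has_weak_deriv \<Omega> \<alpha> u g"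
    and "open U" and "U \<subseteq> \<Omega>" and zero: "AE x in lebesgue_on U. u x = 0"
  shows "AE x in lebesgue_on U. g x = 0"
proof (rule fundamental_lemma_variations[OF \<open>open \<Omega>\<close> _ \<open>open U\<close> \<open>U \<subseteq> \<Omega>\<close>])
  show "locally_integrable \<Omega> g"
    using g by (simp add: has_weak_deriv_def)
  fix \<phi> assume \<phi>: "\<phi> \<in> test_functions U"
  then have sub: "closure {x. \<phi> x \<noteq> 0} \<subseteq> U" and "\<phi> \<in> test_functions \<Omega>"
    using \<open>U \<subseteq> \<Omega>\<close> by (auto simp: test_functions_def)
  then have "(LINT x|lebesgue_on \<Omega>. u x * classical_deriv \<alpha> \<phi> x) =
      (-1) ^ size \<alpha> * (LINT x|lebesgue_on \<Omega>. g x * \<phi> x)"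
    using g by (simp add: has_weak_deriv_def)
  moreover have "(LINT x|lebesgue_on \<Omega>. u x * classical_deriv \<alpha> \<phi> x) = 0"
  proof (rule integral_eq_zero_AE)
    have "AE x in lebesgue. x \<in> U \<longrightarrow> u x = 0"
      using zero \<open>open U\<close> by (simp add: AE_lebesgue_on_iff)
    then have "AE x in lebesgue. x \<in> \<Omega> \<longrightarrow> u x * classical_deriv \<alpha> \<phi> x = 0"
    proof eventually_elim
      case (elim x)
      then show ?case
        using classical_deriv_eq_0[of x \<phi> \<alpha>] subsetD[OF sub, of x] by auto
    qed
    then show "AE x in lebesgue_on \<Omega>. u x * classical_deriv \<alpha> \<phi> x = 0"
      using \<open>open \<Omega>\<close> by (simp add: AE_lebesgue_on_iff)
  qed
  ultimately show "(LINT x|lebesgue_on \<Omega>. g x * \<phi> x) = 0" by simp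
qed

text \<open>\<open>f - g\<close> is a weak derivative of \<open>u - u\<close>, the zero function, so
  locality with \<open>\<Omega>\<close> in the role of \<open>U\<close> applies. This transfers
  facts about any weak derivative to the one chosen in \<open>weak_deriv\<close>.\<close>

lemma has_weak_deriv_unique:
  assumes "open \<Omega>" and "set_mset \<alpha> \<subseteq> Basis"
    and "has_weak_deriv \<Omega> \<alpha> u f" and "has_weak_deriv \<Omega> \<alpha> u g"
  shows "AE x in lebesgue_on \<Omega>. f x = g x"
proof -
  have "AE x in lebesgue_on \<Omega>. (f - g) x = 0"
    by (rule weak_deriv_vanishes[OF assms(1,2) has_weak_deriv_diff[OF assms] assms(1)]) auto
  then show ?thesis by simp
qed

lemma has_weak_deriv_weak_deriv:
  "has_weak_deriv \<Omega> \<alpha> u g \<Longrightarrow> has_weak_deriv \<Omega> \<alpha> u (weak_deriv \<Omega> \<alpha> u)"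
  unfolding weak_deriv_def by (rule someI[of "has_weak_deriv \<Omega> \<alpha> u"])

text \<open>The complement is a union of possibly uncountably many open sets; Lindelof's theorem
  extracts a countable subfamily with the same union, over which the exceptional null sets can be
  collected.\<close>

lemma AE_complement_ess_support: "AE x in lebesgue_on (\<Omega> - ess_support \<Omega> f). f x = 0"
  and open_complement_ess_support: "open (\<Omega> - ess_support \<Omega> f)"
proof -
  let ?F = "{U. open U \<and> U \<subseteq> \<Omega> \<and> (AE x in lebesgue_on U. f x = 0)}"
  have eq: "\<Omega> - ess_support \<Omega> f = \<Union>?F"
    unfolding ess_support_def by blast
  then show op: "open (\<Omega> - ess_support \<Omega> f)" by auto
  obtain G where G: "G \<subseteq> ?F" "countable G" "\<Union>G = \<Union>?F"
    by (rule Lindelof[of ?F]) auto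
  have "AE x in lebesgue. \<forall>U\<in>G. x \<in> U \<longrightarrow> f x = 0"
    using G(1,2) by (subst AE_ball_countable) (auto simp flip: AE_lebesgue_on_iff)
  then have "AE x in lebesgue. x \<in> \<Omega> - ess_support \<Omega> f \<longrightarrow> f x = 0"
    unfolding eq G(3)[symmetric] by eventually_elim blast
  then show "AE x in lebesgue_on (\<Omega> - ess_support \<Omega> f). f x = 0"
    using op by (subst AE_lebesgue_on_iff) auto
qed


section \<open>Lebesgue norms\<close>

lemma enn2real_ge_1: "1 \<le> p \<Longrightarrow> p \<noteq> \<infinity> \<Longrightarrow> 1 \<le> enn2real p"
  by (cases p) (auto simp flip: ennreal_1)

lemma enn2real_le_enn2real: "q \<le> p \<Longrightarrow> p \<noteq> \<infinity> \<Longrightarrow> enn2real q \<le> enn2real p"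
  by (intro enn2real_mono) (auto simp: top.not_eq_extremum)

lemma Lp_finite_iff:
  "p \<noteq> \<infinity> \<Longrightarrow> f \<in> Lp \<Omega> p \<longleftrightarrow> f \<in> borel_measurable (lebesgue_on \<Omega>) \<and>
     integrable (lebesgue_on \<Omega>) (\<lambda>x. \<bar>f x\<bar> powr enn2real p)"
  by (simp add: Lp_def)

lemma Lp_norm_finite:
  "p \<noteq> \<infinity> \<Longrightarrow> Lp_norm \<Omega> p f = (LINT x|lebesgue_on \<Omega>. \<bar>f x\<bar> powr enn2real p) powr (1 / enn2real p)"
  by (simp add: Lp_norm_def)

lemma Lp_measurable: "f \<in> Lp \<Omega> p \<Longrightarrow> f \<in> borel_measurable (lebesgue_on \<Omega>)"
  by (simp add: Lp_def)

lemma Lp_norm_nonneg: "0 \<le> Lp_norm \<Omega> p f"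
proof (cases "p = \<infinity>")
  case True
  let ?M = "lebesgue_on \<Omega>" and ?f = "\<lambda>x. ereal \<bar>f x\<bar>"
  have "0 \<le> esssup ?M ?f \<or> esssup ?M ?f = -\<infinity>"
  proof (rule ccontr)
    assume neg: "\<not> (0 \<le> esssup ?M ?f \<or> esssup ?M ?f = -\<infinity>)"
    have meas: "?f \<in> borel_measurable ?M"
    proof (rule ccontr)
      assume "?f \<notin> borel_measurable ?M"
      from esssup_non_measurable[OF this] neg show False by simp
    qed
    \<comment> \<open>A negative essential supremum would lie above almost every nonnegative value,
      so almost no point exists and any bound holds. What remains is the value minus infinity of a
      null domain, which \<open>real_of_ereal\<close> sends to 0.\<close>
    have "AE x in ?M. ?f x \<le> -\<infinity>"
      using esssup_AE[of ?f ?M]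
    proof eventually_elim
      case (elim x)
      have "0 \<le> ?f x" by simp
      with elim neg show ?case by (meson order_trans)
    qed
    then have "esssup ?M ?f \<le> -\<infinity>"
      using meas by (intro esssup_I)
    with neg show False by simp
  qed
  with True show ?thesis
    by (auto simp: Lp_norm_def real_of_ereal_pos)
qed (simp add: Lp_norm_finite)

lemma Lp_infty_AE_le:
  assumes "f \<in> Lp \<Omega> \<infinity>"
  shows "AE x in lebesgue_on \<Omega>. \<bar>f x\<bar> \<le> Lp_norm \<Omega> \<infinity> f"
  using esssup_AE[of "\<lambda>x. ereal \<bar>f x\<bar>" "lebesgue_on \<Omega>"]
proof eventually_elim
  case (elim x)
  have "esssup (lebesgue_on \<Omega>) (\<lambda>x. ereal \<bar>f x\<bar>) < \<infinity>"
    using assms by (simp add: Lp_def)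
  with elim show ?case
    by (cases "esssup (lebesgue_on \<Omega>) (\<lambda>x. ereal \<bar>f x\<bar>)") (auto simp: Lp_norm_def)
qed

lemma Lp_inftyI:
  assumes "f \<in> borel_measurable (lebesgue_on \<Omega>)" and "AE x in lebesgue_on \<Omega>. \<bar>f x\<bar> \<le> B"
  shows "f \<in> Lp \<Omega> \<infinity>" and "0 \<le> B \<Longrightarrow> Lp_norm \<Omega> \<infinity> f \<le> B"
proof -
  have le: "esssup (lebesgue_on \<Omega>) (\<lambda>x. ereal \<bar>f x\<bar>) \<le> ereal B"
    using assms by (intro esssup_I) auto
  then show "f \<in> Lp \<Omega> \<infinity>"
    using assms(1) by (auto simp: Lp_def)
  show "Lp_norm \<Omega> \<infinity> f \<le> B" if "0 \<le> B"
    using le that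
    by (cases "esssup (lebesgue_on \<Omega>) (\<lambda>x. ereal \<bar>f x\<bar>)") (auto simp: Lp_norm_def)
qed

lemma Lp_norm_finite_le:
  assumes "1 \<le> p" and "p \<noteq> \<infinity>" and "0 \<le> B"
    and le: "(LINT x|lebesgue_on \<Omega>. \<bar>f x\<bar> powr enn2real p) \<le> B powr enn2real p"
  shows "Lp_norm \<Omega> p f \<le> B"
proof -
  have p: "1 \<le> enn2real p" using assms by (simp add: enn2real_ge_1)
  have "Lp_norm \<Omega> p f \<le> (B powr enn2real p) powr (1 / enn2real p)"
    unfolding Lp_norm_finite[OF assms(2)] using p le
    by (intro powr_mono2) (auto intro: integral_nonneg_AE)
  also have "\<dots> = B"
    using p \<open>0 \<le> B\<close> by (simp add: powr_powr)
  finally show ?thesis .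
qed

lemma integral_powr_eq_Lp_norm:
  assumes "1 \<le> p" and "p \<noteq> \<infinity>"
  shows "(LINT x|lebesgue_on \<Omega>. \<bar>f x\<bar> powr enn2real p) = Lp_norm \<Omega> p f powr enn2real p"
  unfolding Lp_norm_finite[OF assms(2)] using enn2real_ge_1[OF assms]
  by (simp add: powr_powr integral_nonneg_AE)

lemma powr_sum_le:
  fixes x y z P :: real
  assumes "0 \<le> x" "x \<le> y + z" "0 \<le> y" "0 \<le> z" "0 \<le> P"
  shows "x powr P \<le> 2 powr P * (y powr P + z powr P)"
proof -
  have "x powr P \<le> (2 * max y z) powr P"
    using assms by (intro powr_mono2) auto
  also have "\<dots> = 2 powr P * max y z powr P"
    using assms by (simp add: powr_mult)
  also have "max y z powr P \<le> y powr P + z powr P"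
    by (cases "y \<le> z") (auto simp: max_def)
  finally show ?thesis by simp
qed

text \<open>The constant 4, in place of Minkowski's 1, is immaterial for estimates up to a constant.\<close>

lemma Lp_dominated:
  assumes "1 \<le> p" and f: "f \<in> Lp \<Omega> p" and g: "g \<in> Lp \<Omega> p"
    and h: "h \<in> borel_measurable (lebesgue_on \<Omega>)"
    and le: "AE x in lebesgue_on \<Omega>. \<bar>h x\<bar> \<le> \<bar>f x\<bar> + \<bar>g x\<bar>"
  shows "h \<in> Lp \<Omega> p" and "Lp_norm \<Omega> p h \<le> 4 * (Lp_norm \<Omega> p f + Lp_norm \<Omega> p g)"
proof -
  let ?F = "Lp_norm \<Omega> p f" and ?G = "Lp_norm \<Omega> p g"
  have nonneg: "0 \<le> ?F" "0 \<le> ?G" by (simp_all add: Lp_norm_nonneg)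
  have "h \<in> Lp \<Omega> p \<and> Lp_norm \<Omega> p h \<le> 4 * (?F + ?G)"
  proof (cases "p = \<infinity>")
    case True
    have "AE x in lebesgue_on \<Omega>. \<bar>h x\<bar> \<le> ?F + ?G"
      using le Lp_infty_AE_le[OF f[unfolded True]] Lp_infty_AE_le[OF g[unfolded True]]
      unfolding True by eventually_elim linarith
    from Lp_inftyI[OF h this] nonneg True show ?thesis by auto
  next
    case False
    let ?P = "enn2real p"
    have P: "1 \<le> ?P" using assms(1) False by (simp add: enn2real_ge_1)
    have ifg: "integrable (lebesgue_on \<Omega>) (\<lambda>x. \<bar>f x\<bar> powr ?P)"
      "integrable (lebesgue_on \<Omega>) (\<lambda>x. \<bar>g x\<bar> powr ?P)"
      using f g by (simp_all add: Lp_finite_iff[OF False])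
    then have dom: "integrable (lebesgue_on \<Omega>) (\<lambda>x. 2 powr ?P * (\<bar>f x\<bar> powr ?P + \<bar>g x\<bar> powr ?P))"
      by (intro integrable_mult_right Bochner_Integration.integrable_add)
    have bound: "AE x in lebesgue_on \<Omega>. \<bar>h x\<bar> powr ?P \<le> 2 powr ?P * (\<bar>f x\<bar> powr ?P + \<bar>g x\<bar> powr ?P)"
      using le by eventually_elim (rule powr_sum_le, use P in auto)
    have ih: "integrable (lebesgue_on \<Omega>) (\<lambda>x. \<bar>h x\<bar> powr ?P)"
    proof (rule Bochner_Integration.integrable_bound[OF dom])
      show "(\<lambda>x. \<bar>h x\<bar> powr ?P) \<in> borel_measurable (lebesgue_on \<Omega>)"
        using h by simp
      show "AE x in lebesgue_on \<Omega>. norm (\<bar>h x\<bar> powr ?P)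
          \<le> norm (2 powr ?P * (\<bar>f x\<bar> powr ?P + \<bar>g x\<bar> powr ?P))"
        using bound by eventually_elim simp
    qed
    have "(LINT x|lebesgue_on \<Omega>. \<bar>h x\<bar> powr ?P)
        \<le> (LINT x|lebesgue_on \<Omega>. 2 powr ?P * (\<bar>f x\<bar> powr ?P + \<bar>g x\<bar> powr ?P))"
      by (rule integral_mono_AE[OF ih dom bound])
    also have "\<dots> = 2 powr ?P * (?F powr ?P + ?G powr ?P)"
      using ifg by (simp add: integral_powr_eq_Lp_norm[OF assms(1) False])
    also have "\<dots> \<le> 2 powr ?P * (2 * (?F + ?G) powr ?P)"
    proof -
      have "?F powr ?P \<le> (?F + ?G) powr ?P" "?G powr ?P \<le> (?F + ?G) powr ?P"
        using nonneg P by (auto intro: powr_mono2)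
      then show ?thesis by (intro mult_left_mono) auto
    qed
    \<comment> \<open>The 2 from adding two powers is absorbed into \<open>2 powr ?P\<close>, as the
      exponent is at least 1; together with the 2 of \<open>powr_sum_le\<close> it makes up the
      4.\<close>
    also have "\<dots> \<le> 2 powr ?P * (2 powr ?P * (?F + ?G) powr ?P)"
    proof -
      have "2 \<le> (2::real) powr ?P"
        using P powr_mono[of 1 ?P 2] by simp
      then show ?thesis by (intro mult_left_mono mult_right_mono) auto
    qed
    also have "\<dots> = (4 * (?F + ?G)) powr ?P"
      using nonneg powr_mult[of 2 2 ?P] by (simp add: powr_mult del: distrib_left_numeral)
    finally have "Lp_norm \<Omega> p h \<le> 4 * (?F + ?G)"
      using nonneg by (intro Lp_norm_finite_le[OF assms(1) False]) auto
    with h ih show ?thesis by (simp add: Lp_finite_iff[OF False])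
  qed
  then show "h \<in> Lp \<Omega> p" "Lp_norm \<Omega> p h \<le> 4 * (?F + ?G)" by auto
qed

lemma Lp_norm_AE_0:
  assumes "f \<in> borel_measurable (lebesgue_on \<Omega>)" and "AE x in lebesgue_on \<Omega>. f x = 0"
  shows "Lp_norm \<Omega> p f = 0"
proof (cases "p = \<infinity>")
  case True
  have "AE x in lebesgue_on \<Omega>. \<bar>f x\<bar> \<le> 0"
    using assms(2) by eventually_elim simp
  from Lp_inftyI(2)[OF assms(1) this] True show ?thesis
    using Lp_norm_nonneg[of \<Omega> p f] by simp
next
  case False
  have "(LINT x|lebesgue_on \<Omega>. \<bar>f x\<bar> powr enn2real p) = 0"
    by (rule integral_eq_zero_AE, use assms(2) in eventually_elim) simp
  then show ?thesis by (simp add: Lp_norm_finite[OF False])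
qed

section \<open>Hoelder's inequality on a set of finite measure\<close>

lemma powr_le_weighted:
  fixes y t P Q :: real
  assumes "0 \<le> y" "0 < t" "1 \<le> Q" "Q \<le> P"
  shows "y powr Q \<le> t powr Q * (Q / P * (y powr P / t powr P) + (1 - Q / P))"
proof (cases "y = 0")
  case True
  then show ?thesis using assms by simp
next
  case False
  \<comment> \<open>Weighted Young inequality for \<open>(y / t) powr P\<close> and 1, with weights
    \<open>Q / P\<close> and \<open>1 - Q / P\<close>. Integrated with a suitable \<open>t\<close>,
    this pointwise bound replaces Hoelder's inequality.\<close>
  have "((y / t) powr P) powr (Q / P) * 1 powr (1 - Q / P) \<le> Q / P * (y / t) powr P + (1 - Q / P) * 1"
    using assms False by (intro Youngs_inequality_0) auto
  then have "(y / t) powr Q \<le> Q / P * (y / t) powr P + (1 - Q / P)"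
    using assms by (simp add: powr_powr)
  then have "t powr Q * (y / t) powr Q \<le> t powr Q * (Q / P * (y / t) powr P + (1 - Q / P))"
    by (intro mult_left_mono) auto
  then show ?thesis
    using assms by (simp add: powr_divide)
qed

lemma Lp_norm_le_of_support:
  assumes "1 \<le> q" and "q \<le> p" and \<Omega>: "\<Omega> \<in> lmeasurable"
    and S: "S \<in> sets lebesgue" "S \<subseteq> \<Omega>" and f: "f \<in> Lp \<Omega> p"
    and zero: "AE x in lebesgue_on \<Omega>. x \<notin> S \<longrightarrow> f x = 0"
  shows "Lp_norm \<Omega> q f \<le> measure lebesgue S powr (1 / enn2real q - 1 / enn2real p) * Lp_norm \<Omega> p f"
proof -
  let ?M = "lebesgue_on \<Omega>" and ?m = "measure lebesgue S" and ?F = "Lp_norm \<Omega> p f"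
  let ?P = "enn2real p" and ?Q = "enn2real q"
  have F: "0 \<le> ?F" by (rule Lp_norm_nonneg)
  have meas: "f \<in> borel_measurable ?M" using f by (rule Lp_measurable)
  have "1 \<le> p" using assms(1,2) by (rule order_trans)
  have SL: "S \<in> lmeasurable"
    by (rule fmeasurableI2[OF \<Omega> S(2,1)])
  have iS: "integrable ?M (indicator S :: _ \<Rightarrow> real)" "(LINT x|?M. indicator S x) = ?m"
  proof -
    have eq: "(\<lambda>x. indicator \<Omega> x *\<^sub>R (indicator S x :: real)) = indicator S"
      by (rule ext) (use S(2) in \<open>auto simp: indicator_def\<close>)
    have \<Omega>': "\<Omega> \<inter> space lebesgue \<in> sets lebesgue"
      using \<Omega> by (simp add: fmeasurableD)
    have "integrable lebesgue (indicator S :: _ \<Rightarrow> real)" "(LINT x|lebesgue. indicator S x) = ?m"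
      using SL by (auto simp: fmeasurable_def)
    then show "integrable ?M (indicator S :: _ \<Rightarrow> real)" "(LINT x|?M. indicator S x) = ?m"
      unfolding integrable_restrict_space[OF \<Omega>'] integral_restrict_space[OF \<Omega>'] eq by simp_all
  qed
  \<comment> \<open>The degenerate cases go first: \<open>t\<close> below needs both quantities
    positive, and \<open>0 powr 0\<close> is 0 rather than 1, which matters when both exponents are
    infinite.\<close>
  show ?thesis
  proof (cases "?m = 0 \<or> ?F = 0")
    case True
    have "AE x in ?M. f x = 0"
    proof (cases "?F = 0")
      case False
      with True have "?m = 0" by simp
      then have "S \<in> null_sets lebesgue"
        using SL by (simp add: negligible_iff_measure flip: negligible_iff_null_sets)
      then have "AE x in lebesgue. x \<notin> S" by (rule AE_not_in)
      then have "AE x in ?M. x \<notin> S"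
        using \<Omega> by (auto simp: AE_lebesgue_on_iff elim: eventually_mono)
      with zero show ?thesis by eventually_elim simp
    next
      case F0: True
      show ?thesis
      proof (cases "p = \<infinity>")
        case True
        then have "AE x in ?M. \<bar>f x\<bar> \<le> 0"
          using Lp_infty_AE_le[OF f[unfolded True]] F0 by simp
        then show ?thesis by eventually_elim simp
      next
        case False
        have P: "1 \<le> ?P" using \<open>1 \<le> p\<close> False by (rule enn2real_ge_1)
        have "(LINT x|?M. \<bar>f x\<bar> powr ?P) = 0"
          using F0 P by (simp add: integral_powr_eq_Lp_norm[OF \<open>1 \<le> p\<close> False])
        then have "AE x in ?M. \<bar>f x\<bar> powr ?P = 0"
          using f by (subst (asm) integral_nonneg_eq_0_iff_AE) (simp_all add: Lp_finite_iff[OF False])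
        then show ?thesis by eventually_elim simp
      qed
    qed
    then have "Lp_norm \<Omega> q f = 0" by (rule Lp_norm_AE_0[OF meas])
    then show ?thesis using F by simp
  next
    case False
    then have m: "0 < ?m" and F0: "0 < ?F"
      using F by (auto simp: less_le)
    show ?thesis
    proof (cases "q = \<infinity>")
      case True
      then have "p = \<infinity>" using \<open>q \<le> p\<close> by (simp add: top_unique)
      with True m show ?thesis by simp
    next
      case q: False
      have Q: "1 \<le> ?Q" using \<open>1 \<le> q\<close> q by (rule enn2real_ge_1)
      let ?B = "?m powr (1 / ?Q - 1 / ?P) * ?F"
      have "(LINT x|?M. \<bar>f x\<bar> powr ?Q) \<le> ?B powr ?Q"
      proof (cases "p = \<infinity>")
        case True
        have "(LINT x|?M. \<bar>f x\<bar> powr ?Q) \<le> (LINT x|?M. ?F powr ?Q * indicator S x)"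
        proof (rule integral_mono_AE')
          have "AE x in ?M. \<bar>f x\<bar> \<le> ?F"
            using Lp_infty_AE_le[OF f[unfolded True]] True by simp
          then show "AE x in ?M. \<bar>f x\<bar> powr ?Q \<le> ?F powr ?Q * indicator S x"
            using zero by eventually_elim (use Q in \<open>auto simp: indicator_def intro: powr_mono2\<close>)
        qed (use iS in auto)
        also have "\<dots> = ?F powr ?Q * ?m" using iS by simp
        also have "\<dots> = ?B powr ?Q"
          using True Q m F by (simp add: powr_mult powr_powr)
        finally show ?thesis .
      next
        case False
        have QP: "?Q \<le> ?P" using \<open>q \<le> p\<close> False by (rule enn2real_le_enn2real)
        \<comment> \<open>\<open>t\<close> is the mean of order \<open>?P\<close> of the absolute
          value of \<open>f\<close> over \<open>S\<close>. With this choice both summands of the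
          Young bound integrate to multiples of \<open>?m\<close> whose weights add up to 1, which
          leaves \<open>t powr ?Q * ?m\<close>.\<close>
        define t where "t = ?F * ?m powr (- 1 / ?P)"
        have t: "0 < t" using m F0 by (simp add: t_def)
        have tP: "t powr ?P = ?F powr ?P / ?m"
        proof -
          have "(?m powr (- 1 / ?P)) powr ?P = ?m powr (- 1)"
            using Q QP unfolding powr_powr by simp
          then show ?thesis
            using m by (simp only: t_def powr_mult) (simp add: powr_minus divide_inverse)
        qed
        let ?g = "\<lambda>x. t powr ?Q * (?Q / ?P * (\<bar>f x\<bar> powr ?P / t powr ?P) + (1 - ?Q / ?P) * indicator S x)"
        have ifP: "integrable ?M (\<lambda>x. \<bar>f x\<bar> powr ?P)"
          using f by (simp add: Lp_finite_iff[OF False])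
        have "(LINT x|?M. \<bar>f x\<bar> powr ?Q) \<le> (LINT x|?M. ?g x)"
        proof (rule integral_mono_AE')
          show "integrable ?M ?g" using ifP iS(1) by simp
          show "AE x in ?M. \<bar>f x\<bar> powr ?Q \<le> ?g x"
            using zero
          proof eventually_elim
            case (elim x)
            show ?case
            proof (cases "x \<in> S")
              case True
              then show ?thesis using powr_le_weighted[OF _ t Q QP, of "\<bar>f x\<bar>"] by simp
            next
              case False
              with elim show ?thesis by simp
            qed
          qed
          show "AE x in ?M. 0 \<le> ?g x"
            using Q QP by (intro AE_I2 mult_nonneg_nonneg add_nonneg_nonneg) auto
        qed
        also have "\<dots> = t powr ?Q * (?Q / ?P * ((LINT x|?M. \<bar>f x\<bar> powr ?P) / t powr ?P) + (1 - ?Q / ?P) * ?m)"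
          using ifP iS by simp
        also have "(LINT x|?M. \<bar>f x\<bar> powr ?P) / t powr ?P = ?m"
          using F0 m by (simp add: tP integral_powr_eq_Lp_norm[OF \<open>1 \<le> p\<close> False])
        also have "t powr ?Q * (?Q / ?P * ?m + (1 - ?Q / ?P) * ?m) = t powr ?Q * ?m"
          by (simp add: algebra_simps)
        also have "\<dots> = ?F powr ?Q * (?m powr (- ?Q / ?P) * ?m powr 1)"
          using m F by (simp add: t_def powr_mult powr_powr)
        also have "\<dots> = ?F powr ?Q * ?m powr ((1 / ?Q - 1 / ?P) * ?Q)"
          using Q unfolding powr_add[symmetric] by (simp add: left_diff_distrib)
        also have "\<dots> = ?B powr ?Q"
          using m F by (simp add: powr_mult powr_powr)
        finally show ?thesis .
      qed
      then show ?thesis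
        using F by (intro Lp_norm_finite_le[OF \<open>1 \<le> q\<close> q]) auto
    qed
  qed
qed


section \<open>Sobolev norms\<close>

text \<open>Completeness of \<open>lebesgue\<close>, applied to the extensions by zero. It is needed
  because the derivative chosen by \<open>SOME\<close> is compared with a measurable one only almost
  everywhere.\<close>

lemma measurable_lebesgue_on_AE_cong:
  fixes f g :: "'a::euclidean_space \<Rightarrow> real"
  assumes "\<Omega> \<in> sets lebesgue" and f: "f \<in> borel_measurable (lebesgue_on \<Omega>)"
    and ae: "AE x in lebesgue_on \<Omega>. f x = g x"
  shows "g \<in> borel_measurable (lebesgue_on \<Omega>)"
proof -
  have \<Omega>: "\<Omega> \<inter> space lebesgue \<in> sets lebesgue" using assms(1) by simp
  have "AE x in lebesgue. x \<in> \<Omega> \<longrightarrow> f x = g x"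
    using ae assms(1) by (simp add: AE_lebesgue_on_iff)
  then have "AE x in lebesgue. indicator \<Omega> x *\<^sub>R f x = indicator \<Omega> x *\<^sub>R g x"
    by eventually_elim (simp add: indicator_def)
  with f show ?thesis
    unfolding borel_measurable_restrict_space_iff[OF \<Omega>] by (rule borel_measurable_AE)
qed

lemma multi_indices_set_mset: "\<alpha> \<in> multi_indices s \<Longrightarrow> set_mset \<alpha> \<subseteq> Basis"
  by (simp add: multi_indices_def)

lemma finite_multi_indices: "finite (multi_indices s :: 'a::euclidean_space multiset set)"
proof -
  have "finite (\<Union>n\<in>{..s}. multisets_of_size (Basis :: 'a set) n)"
    by auto
  then show ?thesis
    by (rule finite_subset[rotated]) (auto simp: multi_indices_def multisets_of_size_def)
qed

lemma empty_in_multi_indices: "{#} \<in> multi_indices s"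
  by (simp add: multi_indices_def)

lemma card_multi_indices: "1 \<le> real (card (multi_indices s :: 'a::euclidean_space multiset set))"
  using finite_multi_indices empty_in_multi_indices
  by (metis One_nat_def Suc_leI card_gt_0_iff empty_iff of_nat_1 of_nat_le_iff)

text \<open>The choice in \<open>weak_deriv\<close> need not pick the integrable witness from
  \<open>sobolev\<close>, but uniqueness makes the two agree almost everywhere; domination by that
  witness, taken twice, then gives membership.\<close>

lemma weak_deriv_Lp:
  assumes "open \<Omega>" and "1 \<le> p" and u: "u \<in> sobolev \<Omega> s p" and \<alpha>: "\<alpha> \<in> multi_indices s"
  shows "has_weak_deriv \<Omega> \<alpha> u (weak_deriv \<Omega> \<alpha> u)" and "weak_deriv \<Omega> \<alpha> u \<in> Lp \<Omega> p"
proof -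
  obtain g where g: "g \<in> Lp \<Omega> p" "has_weak_deriv \<Omega> \<alpha> u g"
    using u \<alpha> by (auto simp: sobolev_def)
  show D: "has_weak_deriv \<Omega> \<alpha> u (weak_deriv \<Omega> \<alpha> u)"
    using g(2) by (rule has_weak_deriv_weak_deriv)
  have ae: "AE x in lebesgue_on \<Omega>. g x = weak_deriv \<Omega> \<alpha> u x"
    by (rule has_weak_deriv_unique[OF assms(1) multi_indices_set_mset[OF \<alpha>] g(2) D])
  have "\<Omega> \<in> sets lebesgue" using \<open>open \<Omega>\<close> by simp
  show "weak_deriv \<Omega> \<alpha> u \<in> Lp \<Omega> p"
  proof (rule Lp_dominated(1)[OF \<open>1 \<le> p\<close> g(1) g(1)])
    show "weak_deriv \<Omega> \<alpha> u \<in> borel_measurable (lebesgue_on \<Omega>)"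
      by (rule measurable_lebesgue_on_AE_cong[OF \<open>\<Omega> \<in> sets lebesgue\<close> Lp_measurable[OF g(1)] ae])
    show "AE x in lebesgue_on \<Omega>. \<bar>weak_deriv \<Omega> \<alpha> u x\<bar> \<le> \<bar>g x\<bar> + \<bar>g x\<bar>"
      using ae by eventually_elim simp
  qed
qed

lemma sobolev_antimono: "m \<le> s \<Longrightarrow> sobolev \<Omega> s p \<subseteq> sobolev \<Omega> m p"
  by (auto simp: sobolev_def multi_indices_def)

lemma sobolev_norm_nonneg: "0 \<le> sobolev_norm \<Omega> s p u"
proof (cases "p = \<infinity>")
  case True
  have "0 \<le> Lp_norm \<Omega> p (weak_deriv \<Omega> {#} u)" by (rule Lp_norm_nonneg)
  also have "\<dots> \<le> (MAX \<alpha>\<in>multi_indices s. Lp_norm \<Omega> p (weak_deriv \<Omega> \<alpha> u))"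
    by (intro Max_ge finite_imageI finite_multi_indices imageI empty_in_multi_indices)
  finally show ?thesis using True by (simp add: sobolev_norm_def)
qed (simp add: sobolev_norm_def)

lemma Lp_norm_weak_deriv_le_sobolev_norm:
  assumes "1 \<le> p" and "\<alpha> \<in> multi_indices s"
  shows "Lp_norm \<Omega> p (weak_deriv \<Omega> \<alpha> u) \<le> sobolev_norm \<Omega> s p u"
proof (cases "p = \<infinity>")
  case True
  have "Lp_norm \<Omega> p (weak_deriv \<Omega> \<alpha> u) \<le> (MAX \<alpha>\<in>multi_indices s. Lp_norm \<Omega> p (weak_deriv \<Omega> \<alpha> u))"
    by (intro Max_ge finite_imageI finite_multi_indices imageI assms)
  with True show ?thesis by (simp add: sobolev_norm_def)
next
  case False
  let ?P = "enn2real p" and ?D = "\<lambda>\<alpha>. Lp_norm \<Omega> p (weak_deriv \<Omega> \<alpha> u)"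
  have P: "1 \<le> ?P" using assms(1) False by (rule enn2real_ge_1)
  have "?D \<alpha> = (?D \<alpha> powr ?P) powr (1 / ?P)"
    using P by (simp add: powr_powr Lp_norm_nonneg)
  also have "\<dots> \<le> (\<Sum>\<alpha>\<in>multi_indices s. ?D \<alpha> powr ?P) powr (1 / ?P)"
    using P assms(2) by (intro powr_mono2 member_le_sum finite_multi_indices) auto
  finally show ?thesis using False by (simp add: sobolev_norm_def)
qed

text \<open>With the previous lemma this makes the Sobolev norm comparable to the largest Lebesgue
  norm of a derivative, up to the number of multi-indices, so that finite and infinite exponents can
  be treated alike from here on.\<close>

lemma sobolev_norm_le:
  fixes \<Omega> :: "'a::euclidean_space set"
  assumes "1 \<le> p" and "0 \<le> B"
    and le: "\<And>\<alpha>. \<alpha> \<in> multi_indices s \<Longrightarrow> Lp_norm \<Omega> p (weak_deriv \<Omega> \<alpha> u) \<le> B"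
  shows "sobolev_norm \<Omega> s p u \<le> real (card (multi_indices s :: 'a multiset set)) * B"
proof (cases "p = \<infinity>")
  case True
  have "(MAX \<alpha>\<in>multi_indices s. Lp_norm \<Omega> p (weak_deriv \<Omega> \<alpha> u)) \<le> B"
    using finite_multi_indices empty_in_multi_indices le by (subst Max_le_iff) auto
  also have "B \<le> real (card (multi_indices s :: 'a multiset set)) * B"
    using mult_right_mono[OF card_multi_indices \<open>0 \<le> B\<close>] by simp
  finally show ?thesis using True by (simp add: sobolev_norm_def)
next
  case False
  let ?P = "enn2real p" and ?D = "\<lambda>\<alpha>. Lp_norm \<Omega> p (weak_deriv \<Omega> \<alpha> u)"
    and ?N = "real (card (multi_indices s :: 'a multiset set))"
  have P: "1 \<le> ?P" using assms(1) False by (rule enn2real_ge_1)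
  have "(\<Sum>\<alpha>\<in>multi_indices s. ?D \<alpha> powr ?P) \<le> (\<Sum>\<alpha>\<in>(multi_indices s :: 'a multiset set). B powr ?P)"
    using P le by (intro sum_mono powr_mono2) (auto simp: Lp_norm_nonneg)
  also have "\<dots> = ?N powr 1 * B powr ?P"
    using card_multi_indices[where 'a = 'a and s = s] by simp
  also have "\<dots> \<le> ?N powr ?P * B powr ?P"
    using P card_multi_indices by (intro mult_right_mono powr_mono) auto
  also have "\<dots> = (?N * B) powr ?P"
    using \<open>0 \<le> B\<close> by (simp add: powr_mult)
  finally have "(\<Sum>\<alpha>\<in>multi_indices s. ?D \<alpha> powr ?P) powr (1 / ?P) \<le> ((?N * B) powr ?P) powr (1 / ?P)"
    using P by (intro powr_mono2) (auto intro: sum_nonneg)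
  then show ?thesis
    using P False \<open>0 \<le> B\<close> by (simp add: sobolev_norm_def powr_powr)
qed

text \<open>Uniqueness identifies the chosen derivative of \<open>u - v\<close> with the difference
  of the chosen ones. The 4 comes from \<open>Lp_dominated\<close>, the cardinality from
  \<open>sobolev_norm_le\<close>.\<close>

lemma sobolev_diff:
  fixes \<Omega> :: "'a::euclidean_space set"
  assumes "open \<Omega>" and "1 \<le> p" and u: "u \<in> sobolev \<Omega> s p" and v: "v \<in> sobolev \<Omega> s p"
  shows "u - v \<in> sobolev \<Omega> s p"
    and "sobolev_norm \<Omega> s p (u - v) \<le> 4 * real (card (multi_indices s :: 'a multiset set)) *
           (sobolev_norm \<Omega> s p u + sobolev_norm \<Omega> s p v)"
proof -
  let ?D = "weak_deriv \<Omega>"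
  have diff: "f - g \<in> Lp \<Omega> p" if "f \<in> Lp \<Omega> p" "g \<in> Lp \<Omega> p" for f g
  proof (rule Lp_dominated(1)[OF \<open>1 \<le> p\<close> that])
    show "f - g \<in> borel_measurable (lebesgue_on \<Omega>)"
      unfolding fun_diff_def using that by (intro borel_measurable_diff Lp_measurable)
  qed (simp add: abs_triangle_ineq4)
  have D: "has_weak_deriv \<Omega> \<alpha> (u - v) (?D \<alpha> u - ?D \<alpha> v)" if "\<alpha> \<in> multi_indices s" for \<alpha>
    using has_weak_deriv_diff[OF assms(1) multi_indices_set_mset[OF that]]
      weak_deriv_Lp(1)[OF assms(1,2) u that] weak_deriv_Lp(1)[OF assms(1,2) v that] .
  show uv: "u - v \<in> sobolev \<Omega> s p"
    unfolding sobolev_def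
  proof (intro CollectI conjI ballI)
    show "u - v \<in> Lp \<Omega> p" using u v by (intro diff) (simp_all add: sobolev_def)
    fix \<alpha> :: "'a multiset" assume \<alpha>: "\<alpha> \<in> multi_indices s"
    show "\<exists>g\<in>Lp \<Omega> p. has_weak_deriv \<Omega> \<alpha> (u - v) g"
      using D[OF \<alpha>] diff[OF weak_deriv_Lp(2)[OF assms(1,2) u \<alpha>] weak_deriv_Lp(2)[OF assms(1,2) v \<alpha>]]
      by blast
  qed
  have "sobolev_norm \<Omega> s p (u - v) \<le> real (card (multi_indices s :: 'a multiset set)) *
      (4 * (sobolev_norm \<Omega> s p u + sobolev_norm \<Omega> s p v))"
  proof (rule sobolev_norm_le[OF \<open>1 \<le> p\<close>])
    show "0 \<le> 4 * (sobolev_norm \<Omega> s p u + sobolev_norm \<Omega> s p v)"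
      by (simp add: sobolev_norm_nonneg)
    fix \<alpha> :: "'a multiset" assume \<alpha>: "\<alpha> \<in> multi_indices s"
    note Duv = weak_deriv_Lp[OF assms(1,2) uv \<alpha>]
    have ae: "AE x in lebesgue_on \<Omega>. ?D \<alpha> (u - v) x = (?D \<alpha> u - ?D \<alpha> v) x"
      by (rule has_weak_deriv_unique[OF assms(1) multi_indices_set_mset[OF \<alpha>] Duv(1) D[OF \<alpha>]])
    have "Lp_norm \<Omega> p (?D \<alpha> (u - v)) \<le> 4 * (Lp_norm \<Omega> p (?D \<alpha> u) + Lp_norm \<Omega> p (?D \<alpha> v))"
    proof (rule Lp_dominated(2)[OF \<open>1 \<le> p\<close> weak_deriv_Lp(2)[OF assms(1,2) u \<alpha>]
          weak_deriv_Lp(2)[OF assms(1,2) v \<alpha>] Lp_measurable[OF Duv(2)]])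
      show "AE x in lebesgue_on \<Omega>. \<bar>?D \<alpha> (u - v) x\<bar> \<le> \<bar>?D \<alpha> u x\<bar> + \<bar>?D \<alpha> v x\<bar>"
        using ae by eventually_elim (simp add: abs_triangle_ineq4)
    qed
    also have "\<dots> \<le> 4 * (sobolev_norm \<Omega> s p u + sobolev_norm \<Omega> s p v)"
      using \<alpha> \<open>1 \<le> p\<close> by (intro mult_left_mono add_mono Lp_norm_weak_deriv_le_sobolev_norm) auto
    finally show "Lp_norm \<Omega> p (?D \<alpha> (u - v)) \<le> 4 * (sobolev_norm \<Omega> s p u + sobolev_norm \<Omega> s p v)" .
  qed
  then show "sobolev_norm \<Omega> s p (u - v) \<le> 4 * real (card (multi_indices s :: 'a multiset set)) *
      (sobolev_norm \<Omega> s p u + sobolev_norm \<Omega> s p v)"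
    by (simp add: algebra_simps)
qed

text \<open>Kept general in \<open>S\<close> to serve twice: for the essential support, where the
  small measure is gained, and for all of \<open>\<Omega>\<close>, where it becomes the embedding
  between exponents.\<close>

lemma sobolev_norm_le_of_support:
  fixes \<Omega> :: "'a::euclidean_space set"
  assumes "open \<Omega>" and "bounded \<Omega>" and "1 \<le> q" and "q \<le> p" and w: "w \<in> sobolev \<Omega> s p"
    and S: "S \<in> sets lebesgue" "S \<subseteq> \<Omega>"
    and zero: "\<And>\<alpha>. \<alpha> \<in> multi_indices s \<Longrightarrow>
      AE x in lebesgue_on \<Omega>. x \<notin> S \<longrightarrow> weak_deriv \<Omega> \<alpha> w x = 0"
  shows "sobolev_norm \<Omega> s q w \<le> real (card (multi_indices s :: 'a multiset set)) *
    (measure lebesgue S powr (1 / enn2real q - 1 / enn2real p) * sobolev_norm \<Omega> s p w)"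
proof (rule sobolev_norm_le[OF \<open>1 \<le> q\<close>])
  let ?c = "measure lebesgue S powr (1 / enn2real q - 1 / enn2real p)"
  have "1 \<le> p" using assms(3,4) by (rule order_trans)
  show "0 \<le> ?c * sobolev_norm \<Omega> s p w"
    by (simp add: sobolev_norm_nonneg)
  fix \<alpha> :: "'a multiset" assume \<alpha>: "\<alpha> \<in> multi_indices s"
  have "Lp_norm \<Omega> q (weak_deriv \<Omega> \<alpha> w) \<le> ?c * Lp_norm \<Omega> p (weak_deriv \<Omega> \<alpha> w)"
    using Lp_norm_le_of_support[OF assms(3,4) lmeasurable_open[OF assms(2,1)] S
        weak_deriv_Lp(2)[OF \<open>open \<Omega>\<close> \<open>1 \<le> p\<close> w \<alpha>] zero[OF \<alpha>]] .
  also have "\<dots> \<le> ?c * sobolev_norm \<Omega> s p w"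
    by (intro mult_left_mono Lp_norm_weak_deriv_le_sobolev_norm \<open>1 \<le> p\<close> \<alpha>) simp
  finally show "Lp_norm \<Omega> q (weak_deriv \<Omega> \<alpha> w) \<le> ?c * sobolev_norm \<Omega> s p w" .
qed

text \<open>The complement of the essential support in \<open>\<Omega>\<close> is open and
  \<open>w\<close> vanishes almost everywhere on it, so locality makes every weak derivative vanish
  there too.\<close>

lemma sobolev_norm_le_ess_support:
  fixes \<Omega> :: "'a::euclidean_space set"
  assumes "open \<Omega>" and "bounded \<Omega>" and "1 \<le> q" and "q \<le> p" and w: "w \<in> sobolev \<Omega> s p"
  shows "sobolev_norm \<Omega> s q w \<le> real (card (multi_indices s :: 'a multiset set)) *
    (measure lebesgue (ess_support \<Omega> w) powr (1 / enn2real q - 1 / enn2real p) * sobolev_norm \<Omega> s p w)"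
proof (rule sobolev_norm_le_of_support[OF assms])
  let ?Z = "\<Omega> - ess_support \<Omega> w"
  show sub: "ess_support \<Omega> w \<subseteq> \<Omega>" by (auto simp: ess_support_def)
  have op: "open ?Z" by (rule open_complement_ess_support)
  have "ess_support \<Omega> w = \<Omega> - ?Z" using sub by blast
  then show "ess_support \<Omega> w \<in> sets lebesgue"
    using \<open>open \<Omega>\<close> op by (metis borel_open sets.Diff sets_completionI_sets sets_lborel)
  fix \<alpha> :: "'a multiset" assume \<alpha>: "\<alpha> \<in> multi_indices s"
  have "1 \<le> p" using assms(3,4) by (rule order_trans)
  have "AE x in lebesgue_on ?Z. weak_deriv \<Omega> \<alpha> w x = 0"
    using weak_deriv_vanishes[OF \<open>open \<Omega>\<close> multi_indices_set_mset[OF \<alpha>]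
        weak_deriv_Lp(1)[OF \<open>open \<Omega>\<close> \<open>1 \<le> p\<close> w \<alpha>] op Diff_subset AE_complement_ess_support] .
  then have "AE x in lebesgue. x \<in> ?Z \<longrightarrow> weak_deriv \<Omega> \<alpha> w x = 0"
    using op by (subst (asm) AE_lebesgue_on_iff) auto
  then have "AE x in lebesgue. x \<in> \<Omega> \<longrightarrow> x \<notin> ess_support \<Omega> w \<longrightarrow> weak_deriv \<Omega> \<alpha> w x = 0"
    by eventually_elim blast
  then show "AE x in lebesgue_on \<Omega>. x \<notin> ess_support \<Omega> w \<longrightarrow> weak_deriv \<Omega> \<alpha> w x = 0"
    using \<open>open \<Omega>\<close> by (subst AE_lebesgue_on_iff) auto
qed

lemma sobolev_norm_le_exponent:
  fixes \<Omega> :: "'a::euclidean_space set"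
  assumes "open \<Omega>" and "bounded \<Omega>" and "1 \<le> q" and "q \<le> p" and w: "w \<in> sobolev \<Omega> s p"
  shows "sobolev_norm \<Omega> s q w \<le> real (card (multi_indices s :: 'a multiset set)) *
    (measure lebesgue \<Omega> powr (1 / enn2real q - 1 / enn2real p) * sobolev_norm \<Omega> s p w)"
  by (rule sobolev_norm_le_of_support[OF assms]) (use \<open>open \<Omega>\<close> in auto)

section \<open>The abstract Galerkin argument\<close>

lemma quadratic_inequality_bound:
  fixes N \<kappa> A B :: real
  assumes "0 < \<kappa>" "0 \<le> A" "0 \<le> B" and le: "\<kappa> * N\<^sup>2 \<le> A * N + B"
  shows "N \<le> A / \<kappa> + sqrt (B / \<kappa>)"
proof (rule ccontr)
  assume "\<not> ?thesis"
  then have gt: "sqrt (B / \<kappa>) < N - A / \<kappa>" by simp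
  have s: "0 \<le> sqrt (B / \<kappa>)" "0 \<le> A / \<kappa>" using assms by simp_all
  \<comment> \<open>If the bound failed, both \<open>N\<close> and \<open>N - A / \<kappa>\<close>
    would exceed \<open>sqrt (B / \<kappa>)\<close>, and their product would exceed
    \<open>B / \<kappa>\<close>, against \<open>le\<close>.\<close>
  have "B / \<kappa> = sqrt (B / \<kappa>) * sqrt (B / \<kappa>)" using assms by simp
  also have "\<dots> < (N - A / \<kappa>) * N"
    using gt s by (intro mult_strict_mono') auto
  finally have "\<kappa> * (B / \<kappa>) < \<kappa> * ((N - A / \<kappa>) * N)"
    using assms(1) by (rule mult_strict_left_mono)
  then show False
    using assms(1) le by (simp add: algebra_simps power2_eq_square)
qed

text \<open>
  The overlap element \<open>z\<close> is an admissible test function for both projections, so that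
  \<open>a' (r' u - r u) z\<close> reduces to the consistency error of the two forms.
\<close>

lemma galerkin_difference_estimate:
  fixes V W W' :: "('a \<Rightarrow> real) set" and n :: "('a \<Rightarrow> real) \<Rightarrow> real"
  assumes V: "fun_subspace V" and "W \<subseteq> V" and "W' \<subseteq> V"
    and bil: "bilinear_form_on V a" "bilinear_form_on V a'"
    and r: "galerkin_projector V W a r" and r': "galerkin_projector V W' a' r'"
    and "0 < \<kappa>" and "0 \<le> M" and n: "\<And>v. 0 \<le> n v"
    and coer: "\<And>v. v \<in> V \<Longrightarrow> \<kappa> * (n v)\<^sup>2 \<le> a' v v"
    and cont: "\<And>v w. v \<in> V \<Longrightarrow> w \<in> V \<Longrightarrow> a' v w \<le> M * n v * n w"
    and u: "u \<in> V" and z: "z \<in> W' \<inter> W"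
    and cons: "\<bar>a' (r u - u) z - a (r u - u) z\<bar> \<le> B"
  shows "n (r' u - r u) \<le> M * n (r' u - r u - z) / \<kappa> + sqrt (B / \<kappa>)"
proof -
  note diff = fun_space.subspace_diff[OF V]
  have ru: "r u \<in> V" "a (r u - u) z = 0"
    using r u z \<open>W \<subseteq> V\<close> by (auto simp: galerkin_projector_def)
  have r'u: "r' u \<in> V" "a' (r' u - u) z = 0"
    using r' u z \<open>W' \<subseteq> V\<close> by (auto simp: galerkin_projector_def)
  have zV: "z \<in> V" using z \<open>W \<subseteq> V\<close> by blast
  let ?e = "r' u - r u"
  have e: "?e \<in> V" "?e - z \<in> V" "r u - u \<in> V"
    using diff ru(1) r'u(1) zV u by simp_all
  have "a' (?e + (r u - u)) z = a' ?e z + a' (r u - u) z"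
    using bil(2) e zV unfolding bilinear_form_on_def by blast
  moreover have "?e + (r u - u) = r' u - u" by simp
  ultimately have ez: "a' ?e z = - a' (r u - u) z"
    using r'u(2) by simp
  have "a' ?e ((?e - z) + z) = a' ?e (?e - z) + a' ?e z"
    using bil(2) e zV unfolding bilinear_form_on_def by blast
  moreover have "(?e - z) + z = ?e" by simp
  ultimately have ee: "a' ?e ?e = a' ?e (?e - z) - a' (r u - u) z"
    using ez by simp
  have "\<kappa> * (n ?e)\<^sup>2 \<le> a' ?e ?e"
    using coer e(1) by blast
  also have "\<dots> \<le> M * n ?e * n (?e - z) + B"
    using ee cont[OF e(1,2)] cons ru(2) by linarith
  finally have "\<kappa> * (n ?e)\<^sup>2 \<le> (M * n (?e - z)) * n ?e + B"
    by (simp add: mult_ac)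
  then show ?thesis
    using \<open>0 < \<kappa>\<close> \<open>0 \<le> M\<close> n cons
    by (intro quadratic_inequality_bound) (auto intro: order_trans[OF abs_ge_zero])
qed


section \<open>The estimate\<close>

text \<open>Default values agree with the convention on reciprocals: for infinite \<open>p\<close>
  both sides are 0, and for \<open>p = 0\<close> the infinite quotient is sent to 0, as is the real
  quotient by 0.\<close>

lemma enn2real_inverse: "enn2real (1 / p) = 1 / enn2real p"
proof (cases p)
  case (real x)
  then show ?thesis
    by (cases "x = 0") (simp_all add: divide_ennreal flip: ennreal_1)
qed simp

text \<open>Lowers an exponent of \<open>h\<close> although \<open>h\<close> may exceed 1; the
  surplus power is bounded at \<open>h\<^sub>0\<close>.\<close>

lemma powr_le_mult_powr:
  fixes h h\<^sub>0 a b :: real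
  assumes "0 < h" "h \<le> h\<^sub>0" "b \<le> a"
  shows "h powr a \<le> h\<^sub>0 powr (a - b) * h powr b"
proof -
  have "h powr a = h powr (a - b) * h powr b"
    by (simp flip: powr_add)
  also have "\<dots> \<le> h\<^sub>0 powr (a - b) * h powr b"
    using assms by (intro mult_right_mono powr_mono2) auto
  finally show ?thesis .
qed

theorem theorem2p2:
  fixes \<Omega> :: "'a::euclidean_space set"
    and s \<mu> \<nu> :: nat
    and V :: "('a \<Rightarrow> real) set"
    and h\<^sub>0 \<gamma> \<delta> C\<^sub>1 :: real
    and \<eta> q :: ennreal
    and a a' :: "real \<Rightarrow> ('a \<Rightarrow> real) \<Rightarrow> ('a \<Rightarrow> real) \<Rightarrow> real"
    and W W' :: "real \<Rightarrow> ('a \<Rightarrow> real) set"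
    and r r' \<pi> :: "real \<Rightarrow> ('a \<Rightarrow> real) \<Rightarrow> ('a \<Rightarrow> real)"
  defines "\<sigma> \<equiv> min (\<gamma> * (1 / 2 - enn2real (1 / \<eta>))) ((\<delta> + 2 * real s - real \<mu> - real \<nu>) / 2)"
  assumes "bounded \<Omega>" and "lipschitz_domain \<Omega>"
    and "closed_sobolev_subspace \<Omega> s 2 V"
    and "h\<^sub>0 > 0"
    and "\<And>h. h \<in> {0<..h\<^sub>0} \<Longrightarrow> bilinear_form_on V (a h)"
    and "\<And>h. h \<in> {0<..h\<^sub>0} \<Longrightarrow> bilinear_form_on V (a' h)"
    and "uniformly_continuous_coercive \<Omega> s V h\<^sub>0 a a'"
    and "\<And>h. h \<in> {0<..h\<^sub>0} \<Longrightarrow> fin_dim_subspace \<Omega> V (W h)"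
    and "\<And>h. h \<in> {0<..h\<^sub>0} \<Longrightarrow> fin_dim_subspace \<Omega> V (W' h)"
    and "\<And>h. h \<in> {0<..h\<^sub>0} \<Longrightarrow> galerkin_projector V (W h) (a h) (r h)"
    and "\<And>h. h \<in> {0<..h\<^sub>0} \<Longrightarrow> galerkin_projector V (W' h) (a' h) (r' h)"
    and "2 \<le> \<eta>"
    and cond_i: "\<And>h. h \<in> {0<..h\<^sub>0} \<Longrightarrow>
          W h \<subseteq> sobolev \<Omega> s \<eta> \<inter> V \<and> W' h \<subseteq> sobolev \<Omega> s \<eta> \<inter> V"
    and cond_ii: "\<exists>C>0. \<forall>h\<in>{0<..h\<^sub>0}. \<forall>m\<le>s. \<forall>w \<in> W' h \<inter> W h.
          sobolev_norm \<Omega> m \<eta> w \<le> C * h powr (- real m) * sobolev_norm \<Omega> 0 \<eta> w"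
    and "\<gamma> \<ge> 0"
    and cond_iii: "\<exists>C>0. \<forall>h\<in>{0<..h\<^sub>0}. \<forall>w \<in> W' h + W h.
          \<pi> h w \<in> W' h \<inter> W h \<and>
          sobolev_norm \<Omega> 0 \<eta> (\<pi> h w) \<le> C * sobolev_norm \<Omega> 0 \<eta> w \<and>
          measure lebesgue (ess_support \<Omega> (\<pi> h w - w)) \<le> C * h powr \<gamma>"
    and "C\<^sub>1 > 0" and "\<delta> \<ge> 0" and "1 \<le> q" and "q \<le> \<eta>" and "\<mu> \<le> s" and "\<nu> \<le> s"
    and "\<And>h v w. h \<in> {0<..h\<^sub>0} \<Longrightarrow> v \<in> sobolev \<Omega> s \<eta> \<inter> V \<Longrightarrow> w \<in> sobolev \<Omega> s \<eta> \<inter> V \<Longrightarrow>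
          \<bar>a' h v w - a h v w\<bar> \<le>
            C\<^sub>1 * h powr \<delta> * sobolev_norm \<Omega> \<mu> \<eta> v * sobolev_norm \<Omega> \<nu> q w"
  shows "\<exists>C>0. \<forall>h\<in>{0<..h\<^sub>0}. \<forall>u \<in> sobolev \<Omega> s \<eta> \<inter> V.
     sobolev_norm \<Omega> s 2 (r' h u - r h u) \<le>
       C * h powr (\<sigma> - real s) *
       (h ^ s * sobolev_norm \<Omega> s \<eta> (r' h u - u) + h ^ s * sobolev_norm \<Omega> s \<eta> (r h u - u)
        + sobolev_norm \<Omega> 0 \<eta> (r' h u - u) + sobolev_norm \<Omega> 0 \<eta> (r h u - u)
        + sqrt (h ^ \<mu> * sobolev_norm \<Omega> \<mu> \<eta> (r h u - u))
          * sqrt (sobolev_norm \<Omega> 0 \<eta> (r' h u - u) + sobolev_norm \<Omega> 0 \<eta> (r h u - u)))"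
proof -
  note bil = assms(6) and bil' = assms(7) and W = assms(9) and proj = assms(11) and proj' = assms(12)
    and consistency = assms(24)
  have open_\<Omega>: "open \<Omega>"
    using \<open>lipschitz_domain \<Omega>\<close> by (simp add: lipschitz_domain_def)
  have V: "V \<subseteq> sobolev \<Omega> s 2" "fun_subspace V"
    using \<open>closed_sobolev_subspace \<Omega> s 2 V\<close> by (simp_all add: closed_sobolev_subspace_def)
  have \<eta>: "1 \<le> \<eta>"
    using \<open>1 \<le> q\<close> \<open>q \<le> \<eta>\<close> by (rule order_trans)
  obtain \<kappa> M where \<kappa>: "\<kappa> > 0" and M: "M > 0"
    and forms: "\<And>h v w. h \<in> {0<..h\<^sub>0} \<Longrightarrow> v \<in> V \<Longrightarrow> w \<in> V \<Longrightarrow>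
      a' h v v \<ge> \<kappa> * (sobolev_norm \<Omega> s 2 v)\<^sup>2 \<and>
      a' h v w \<le> M * sobolev_norm \<Omega> s 2 v * sobolev_norm \<Omega> s 2 w"
    using \<open>uniformly_continuous_coercive \<Omega> s V h\<^sub>0 a a'\<close>
    unfolding uniformly_continuous_coercive_def by blast
  obtain C\<^sub>2 where C2: "C\<^sub>2 > 0" and inv: "\<And>h m w. h \<in> {0<..h\<^sub>0} \<Longrightarrow> m \<le> s \<Longrightarrow> w \<in> W' h \<inter> W h \<Longrightarrow>
      sobolev_norm \<Omega> m \<eta> w \<le> C\<^sub>2 * h powr (- real m) * sobolev_norm \<Omega> 0 \<eta> w"
    using cond_ii by blast
  obtain C\<^sub>3 where C3: "C\<^sub>3 > 0" and \<pi>: "\<And>h w. h \<in> {0<..h\<^sub>0} \<Longrightarrow> w \<in> W' h + W h \<Longrightarrow>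
      \<pi> h w \<in> W' h \<inter> W h \<and>
      sobolev_norm \<Omega> 0 \<eta> (\<pi> h w) \<le> C\<^sub>3 * sobolev_norm \<Omega> 0 \<eta> w \<and>
      measure lebesgue (ess_support \<Omega> (\<pi> h w - w)) \<le> C\<^sub>3 * h powr \<gamma>"
    using cond_iii by blast
  define N :: "nat \<Rightarrow> real" where "N m = real (card (multi_indices m :: 'a multiset set))" for m
  have N: "0 \<le> N m" for m by (simp add: N_def)
  \<comment> \<open>The power of the measure gained by passing from exponent \<open>\<eta>\<close>
    to 2; it is 1/2 for infinite \<open>\<eta>\<close>, since \<open>enn2real \<infinity>\<close> is
    0 and division by 0 yields 0.\<close>
  define t where "t = 1 / 2 - 1 / enn2real \<eta>"
  have t: "0 \<le> t"
  proof (cases "\<eta> = \<infinity>")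
    case False
    then have "enn2real 2 \<le> enn2real \<eta>"
      using \<open>2 \<le> \<eta>\<close> by (intro enn2real_le_enn2real)
    then show ?thesis by (simp add: t_def field_simps)
  qed (simp add: t_def)
  define \<tau> where "\<tau> = (\<delta> + 2 * real s - real \<mu> - real \<nu>) / 2"
  have \<sigma>: "\<sigma> \<le> \<gamma> * t" "\<sigma> \<le> \<tau>"
    unfolding \<sigma>_def t_def \<tau>_def enn2real_inverse by (rule min.cobounded1 min.cobounded2)+
  \<comment> \<open>\<open>c\<close> belongs to the passage from exponent \<open>\<eta>\<close> to
    \<open>q\<close> on \<open>\<Omega>\<close>; \<open>K\<^sub>0\<close> and
    \<open>K\<^sub>s\<close> to the triangle inequality in orders 0 and \<open>s\<close>;
    \<open>K\<^sub>1\<close> to \<open>e - z\<close> in order \<open>s\<close>;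
    \<open>K\<^sub>2\<close> to the same after passing to exponent 2 on its support;
    \<open>K\<^sub>3\<close> to the consistency error tested with \<open>z\<close>.\<close>
  define c where "c = measure lebesgue \<Omega> powr (1 / enn2real q - 1 / enn2real \<eta>)"
  define K\<^sub>0 where "K\<^sub>0 = 4 * N 0"
  define K\<^sub>s where "K\<^sub>s = 4 * N s"
  define K\<^sub>1 where "K\<^sub>1 = K\<^sub>s * (K\<^sub>s + C\<^sub>2 * C\<^sub>3 * K\<^sub>0)"
  define K\<^sub>2 where "K\<^sub>2 = N s * C\<^sub>3 powr t * K\<^sub>1"
  define K\<^sub>3 where "K\<^sub>3 = C\<^sub>1 * N \<nu> * c * C\<^sub>2 * C\<^sub>3 * K\<^sub>0"
  have K: "0 \<le> c" "0 \<le> K\<^sub>0" "0 \<le> K\<^sub>s" "0 \<le> K\<^sub>1" "0 \<le> K\<^sub>2" "0 \<le> K\<^sub>3"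
    using C2 C3 N \<open>C\<^sub>1 > 0\<close>
    by (simp_all add: c_def K\<^sub>0_def K\<^sub>s_def K\<^sub>1_def K\<^sub>2_def K\<^sub>3_def)
  \<comment> \<open>The powers of \<open>h\<^sub>0\<close> pay for lowering both exponents to
    \<open>\<sigma>\<close>; the summand 1 secures strict positivity.\<close>
  define C where "C = M * K\<^sub>2 / \<kappa> * h\<^sub>0 powr (\<gamma> * t - \<sigma>) + sqrt (K\<^sub>3 / \<kappa>) * h\<^sub>0 powr (\<tau> - \<sigma>) + 1"
  have "0 < C"
    using K \<kappa> M by (simp add: C_def add_nonneg_pos)
  moreover have "sobolev_norm \<Omega> s 2 (r' h u - r h u) \<le>
       C * h powr (\<sigma> - real s) *
       (h ^ s * sobolev_norm \<Omega> s \<eta> (r' h u - u) + h ^ s * sobolev_norm \<Omega> s \<eta> (r h u - u)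
        + sobolev_norm \<Omega> 0 \<eta> (r' h u - u) + sobolev_norm \<Omega> 0 \<eta> (r h u - u)
        + sqrt (h ^ \<mu> * sobolev_norm \<Omega> \<mu> \<eta> (r h u - u))
          * sqrt (sobolev_norm \<Omega> 0 \<eta> (r' h u - u) + sobolev_norm \<Omega> 0 \<eta> (r h u - u)))"
    if h: "h \<in> {0<..h\<^sub>0}" and u: "u \<in> sobolev \<Omega> s \<eta> \<inter> V" for h u
  proof -
    have h0: "0 < h" "h \<le> h\<^sub>0" using h by auto
    have sub: "W h \<subseteq> V" "W' h \<subseteq> V" "W h \<subseteq> sobolev \<Omega> s \<eta>" "W' h \<subseteq> sobolev \<Omega> s \<eta>"
      using cond_i[OF h] by blast+
    have Wsub: "fun_subspace (W h)"
      using W[OF h] by (simp add: fin_dim_subspace_def)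
    note r = proj[OF h] and r' = proj'[OF h]
    have mem: "r h u \<in> W h" "r' h u \<in> W' h"
      using r r' u by (auto simp: galerkin_projector_def)
    define e where "e = r' h u - r h u"
    define v where "v = r h u - u"
    define v' where "v' = r' h u - u"
    define z where "z = \<pi> h e"
    have e_eq: "e = v' - v" by (simp add: e_def v_def v'_def)
    have "e = r' h u + (\<lambda>x. (-1) * r h u x)"
      by (simp add: e_def fun_eq_iff)
    moreover have "(\<lambda>x. (-1) * r h u x) \<in> W h"
      using fun_space.subspace_scale[OF Wsub mem(1)] .
    ultimately have eW: "e \<in> W' h + W h"
      using mem(2) by (auto simp: set_plus_def)
    have z: "z \<in> W' h \<inter> W h" "sobolev_norm \<Omega> 0 \<eta> z \<le> C\<^sub>3 * sobolev_norm \<Omega> 0 \<eta> e"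
      "measure lebesgue (ess_support \<Omega> (z - e)) \<le> C\<^sub>3 * h powr \<gamma>"
      using \<pi>[OF h eW] by (simp_all add: z_def)
    have supp: "ess_support \<Omega> (e - z) = ess_support \<Omega> (z - e)"
    proof -
      have "(e - z) x = 0 \<longleftrightarrow> (z - e) x = 0" for x by auto
      then show ?thesis unfolding ess_support_def by presburger
    qed
    have ru: "r h u \<in> sobolev \<Omega> s \<eta>" "r' h u \<in> sobolev \<Omega> s \<eta>" "u \<in> sobolev \<Omega> s \<eta>"
      and ruV: "r h u \<in> V" "u \<in> V"
      using mem sub u by auto
    have S: "v \<in> sobolev \<Omega> s \<eta>" "v' \<in> sobolev \<Omega> s \<eta>" "e \<in> sobolev \<Omega> s \<eta>" "z \<in> sobolev \<Omega> s \<eta>"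
      using sobolev_diff(1)[OF open_\<Omega> \<eta>] ru subsetD[OF sub(3)] z(1)
      by (simp_all add: e_def v_def v'_def)
    have vV: "v \<in> V" "z \<in> V"
      using fun_space.subspace_diff[OF V(2) ruV] subsetD[OF sub(1)] z(1) by (simp_all add: v_def)

    define E\<^sub>0 where "E\<^sub>0 = sobolev_norm \<Omega> 0 \<eta> v' + sobolev_norm \<Omega> 0 \<eta> v"
    define E\<^sub>s where "E\<^sub>s = sobolev_norm \<Omega> s \<eta> v' + sobolev_norm \<Omega> s \<eta> v"
    define E\<^sub>\<mu> where "E\<^sub>\<mu> = sobolev_norm \<Omega> \<mu> \<eta> v"
    have E: "0 \<le> E\<^sub>0" "0 \<le> E\<^sub>s" "0 \<le> E\<^sub>\<mu>"
      by (simp_all add: E\<^sub>0_def E\<^sub>s_def E\<^sub>\<mu>_def sobolev_norm_nonneg)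
    have e0: "sobolev_norm \<Omega> 0 \<eta> e \<le> K\<^sub>0 * E\<^sub>0"
      unfolding e_eq K\<^sub>0_def E\<^sub>0_def N_def
      by (rule sobolev_diff(2)[OF open_\<Omega> \<eta>]) (use S sobolev_antimono[of 0 s] in auto)
    have es: "sobolev_norm \<Omega> s \<eta> e \<le> K\<^sub>s * E\<^sub>s"
      unfolding e_eq K\<^sub>s_def E\<^sub>s_def N_def
      by (rule sobolev_diff(2)[OF open_\<Omega> \<eta> S(2,1)])
    have z0: "sobolev_norm \<Omega> 0 \<eta> z \<le> C\<^sub>3 * (K\<^sub>0 * E\<^sub>0)"
      by (rule order_trans[OF z(2) mult_left_mono[OF e0]]) (use C3 in simp)
    \<comment> \<open>Stability of \<open>\<pi>\<close> holds in order 0 only; the inverse estimate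
      trades \<open>m\<close> derivatives for \<open>h powr (- m)\<close>, so only the errors
      collected in \<open>E\<^sub>0\<close> enter.\<close>
    have zm: "sobolev_norm \<Omega> m \<eta> z \<le> C\<^sub>2 * h powr (- real m) * (C\<^sub>3 * (K\<^sub>0 * E\<^sub>0))" if "m \<le> s" for m
      by (rule order_trans[OF inv[OF h that z(1)] mult_left_mono[OF z0]]) (use C2 in simp)

    have "sobolev_norm \<Omega> s \<eta> (e - z) \<le> K\<^sub>s * (sobolev_norm \<Omega> s \<eta> e + sobolev_norm \<Omega> s \<eta> z)"
      unfolding K\<^sub>s_def N_def by (rule sobolev_diff(2)[OF open_\<Omega> \<eta> S(3,4)])
    also have "\<dots> \<le> K\<^sub>s * (K\<^sub>s * E\<^sub>s + C\<^sub>2 * h powr (- real s) * (C\<^sub>3 * (K\<^sub>0 * E\<^sub>0)))"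
      using es zm[of s] K by (intro mult_left_mono add_mono) auto
    also have "\<dots> = h powr (- real s) * (K\<^sub>s * (K\<^sub>s * (h ^ s * E\<^sub>s) + C\<^sub>2 * C\<^sub>3 * K\<^sub>0 * E\<^sub>0))"
      using h0 by (simp add: powr_minus powr_realpow field_simps)
    also have "\<dots> \<le> h powr (- real s) * (K\<^sub>1 * (h ^ s * E\<^sub>s + E\<^sub>0))"
    proof (rule mult_left_mono)
      \<comment> \<open>These two cross terms are exactly the difference of the two sides
        below.\<close>
      have "0 \<le> K\<^sub>s * (C\<^sub>2 * C\<^sub>3 * K\<^sub>0) * (h ^ s * E\<^sub>s) + K\<^sub>s * K\<^sub>s * E\<^sub>0"
        using K C2 C3 E h0 by simp
      then show "K\<^sub>s * (K\<^sub>s * (h ^ s * E\<^sub>s) + C\<^sub>2 * C\<^sub>3 * K\<^sub>0 * E\<^sub>0) \<le> K\<^sub>1 * (h ^ s * E\<^sub>s + E\<^sub>0)"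
        by (simp add: K\<^sub>1_def algebra_simps)
    qed simp
    finally have ez: "sobolev_norm \<Omega> s \<eta> (e - z) \<le> h powr (- real s) * (K\<^sub>1 * (h ^ s * E\<^sub>s + E\<^sub>0))" .

    have "sobolev_norm \<Omega> s 2 (e - z) \<le>
        N s * (measure lebesgue (ess_support \<Omega> (z - e)) powr t * sobolev_norm \<Omega> s \<eta> (e - z))"
      using sobolev_norm_le_ess_support[OF open_\<Omega> \<open>bounded \<Omega>\<close> _ \<open>2 \<le> \<eta>\<close>
          sobolev_diff(1)[OF open_\<Omega> \<eta> S(3,4)]]
      by (simp add: N_def t_def supp)
    also have "\<dots> \<le> N s * ((C\<^sub>3 * h powr \<gamma>) powr t * (h powr (- real s) * (K\<^sub>1 * (h ^ s * E\<^sub>s + E\<^sub>0))))"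
      using z(3) t N ez by (intro mult_left_mono mult_mono powr_mono2) (auto simp: sobolev_norm_nonneg)
    also have "\<dots> = K\<^sub>2 * h powr (\<gamma> * t - real s) * (h ^ s * E\<^sub>s + E\<^sub>0)"
      using C3 h0 by (simp add: K\<^sub>2_def powr_mult powr_powr powr_diff powr_minus divide_inverse)
    finally have A: "sobolev_norm \<Omega> s 2 (e - z) \<le> K\<^sub>2 * h powr (\<gamma> * t - real s) * (h ^ s * E\<^sub>s + E\<^sub>0)" .

    have "sobolev_norm \<Omega> \<nu> q z \<le> N \<nu> * (c * sobolev_norm \<Omega> \<nu> \<eta> z)"
      unfolding N_def c_def
      by (rule sobolev_norm_le_exponent[OF open_\<Omega> \<open>bounded \<Omega>\<close> \<open>1 \<le> q\<close> \<open>q \<le> \<eta>\<close>])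
        (use S(4) sobolev_antimono[OF \<open>\<nu> \<le> s\<close>] in auto)
    also have "\<dots> \<le> N \<nu> * (c * (C\<^sub>2 * h powr (- real \<nu>) * (C\<^sub>3 * (K\<^sub>0 * E\<^sub>0))))"
      by (intro mult_left_mono zm N K \<open>\<nu> \<le> s\<close>)
    finally have zq: "sobolev_norm \<Omega> \<nu> q z \<le> N \<nu> * (c * (C\<^sub>2 * h powr (- real \<nu>) * (C\<^sub>3 * (K\<^sub>0 * E\<^sub>0))))" .

    have "\<bar>a' h v z - a h v z\<bar> \<le> C\<^sub>1 * h powr \<delta> * E\<^sub>\<mu> * sobolev_norm \<Omega> \<nu> q z"
      unfolding E\<^sub>\<mu>_def using S vV by (intro consistency[OF h]) auto
    also have "\<dots> \<le> C\<^sub>1 * h powr \<delta> * E\<^sub>\<mu> * (N \<nu> * (c * (C\<^sub>2 * h powr (- real \<nu>) * (C\<^sub>3 * (K\<^sub>0 * E\<^sub>0)))))"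
      using zq E \<open>C\<^sub>1 > 0\<close> by (intro mult_left_mono) auto
    also have "\<dots> = K\<^sub>3 * (h powr \<delta> * h powr (- real \<nu>)) * (E\<^sub>\<mu> * E\<^sub>0)"
      by (simp add: K\<^sub>3_def)
    \<comment> \<open>By the choice of \<open>\<tau>\<close>, twice \<open>\<tau> - s\<close> plus
      \<open>\<mu>\<close> is \<open>\<delta> - \<nu>\<close>. Leaving \<open>h ^ \<mu>\<close> to
      the error of order \<open>\<mu>\<close> thus makes the rest a perfect square, whose root is
      \<open>h powr (\<tau> - s)\<close>.\<close>
    also have "h powr \<delta> * h powr (- real \<nu>) = (h powr (\<tau> - real s))\<^sup>2 * h ^ \<mu>"
    proof -
      have "(h powr (\<tau> - real s))\<^sup>2 * h ^ \<mu> = h powr (\<tau> - real s) * h powr (\<tau> - real s) * h powr real \<mu>"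
        using h0 by (simp add: power2_eq_square powr_realpow)
      also have "\<dots> = h powr (\<delta> + - real \<nu>)"
      proof -
        have "\<tau> - real s + (\<tau> - real s) + real \<mu> = \<delta> + - real \<nu>"
          by (simp add: \<tau>_def field_simps)
        then show ?thesis by (simp flip: powr_add)
      qed
      finally show ?thesis by (simp flip: powr_add)
    qed
    finally have B: "\<bar>a' h v z - a h v z\<bar> \<le> K\<^sub>3 * ((h powr (\<tau> - real s))\<^sup>2 * h ^ \<mu>) * (E\<^sub>\<mu> * E\<^sub>0)" .

    \<comment> \<open>\<open>X + Y\<close> is the bracket of the claim: \<open>Y\<close> is the
      square-root term from consistency, \<open>X\<close> everything else.\<close>
    define X where "X = h ^ s * E\<^sub>s + E\<^sub>0"
    define Y where "Y = sqrt (h ^ \<mu> * E\<^sub>\<mu>) * sqrt E\<^sub>0"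
    have XY: "0 \<le> X" "0 \<le> Y" using E h0 by (simp_all add: X_def Y_def)
    have "sobolev_norm \<Omega> s 2 e \<le> M * sobolev_norm \<Omega> s 2 (e - z) / \<kappa>
        + sqrt (K\<^sub>3 * ((h powr (\<tau> - real s))\<^sup>2 * h ^ \<mu>) * (E\<^sub>\<mu> * E\<^sub>0) / \<kappa>)"
      unfolding e_def
    proof (rule galerkin_difference_estimate[OF V(2) sub(1,2) bil[OF h] bil'[OF h] r r' \<kappa>])
      show "\<bar>a' h (r h u - u) z - a h (r h u - u) z\<bar>
          \<le> K\<^sub>3 * ((h powr (\<tau> - real s))\<^sup>2 * h ^ \<mu>) * (E\<^sub>\<mu> * E\<^sub>0)"
        using B by (simp only: v_def)
    qed (use M h u z(1) forms sobolev_norm_nonneg in auto)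
    also have "sqrt (K\<^sub>3 * ((h powr (\<tau> - real s))\<^sup>2 * h ^ \<mu>) * (E\<^sub>\<mu> * E\<^sub>0) / \<kappa>)
        = sqrt (K\<^sub>3 / \<kappa>) * h powr (\<tau> - real s) * Y"
      by (simp add: Y_def real_sqrt_mult real_sqrt_divide)
    also have "M * sobolev_norm \<Omega> s 2 (e - z) / \<kappa> \<le> M * K\<^sub>2 / \<kappa> * h powr (\<gamma> * t - real s) * X"
      using divide_right_mono[OF mult_left_mono[OF A, of M], of \<kappa>] M \<kappa> by (simp add: X_def mult_ac)
    \<comment> \<open>The two contributions carry the exponents \<open>\<gamma> * t - s\<close> and
      \<open>\<tau> - s\<close>; both are lowered to the common \<open>\<sigma> - s\<close>.\<close>
    also have "\<dots> \<le> M * K\<^sub>2 / \<kappa> * (h\<^sub>0 powr (\<gamma> * t - \<sigma>) * h powr (\<sigma> - real s)) * X"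
      using powr_le_mult_powr[OF h0, of "\<sigma> - real s" "\<gamma> * t - real s"] \<sigma> M \<kappa> K XY
      by (intro mult_right_mono mult_left_mono) auto
    also have "sqrt (K\<^sub>3 / \<kappa>) * h powr (\<tau> - real s) * Y
        \<le> sqrt (K\<^sub>3 / \<kappa>) * (h\<^sub>0 powr (\<tau> - \<sigma>) * h powr (\<sigma> - real s)) * Y"
      using powr_le_mult_powr[OF h0, of "\<sigma> - real s" "\<tau> - real s"] \<sigma> \<kappa> K XY
      by (intro mult_right_mono mult_left_mono) auto
    finally have "sobolev_norm \<Omega> s 2 e \<le>
        M * K\<^sub>2 / \<kappa> * h\<^sub>0 powr (\<gamma> * t - \<sigma>) * (h powr (\<sigma> - real s) * X)
        + sqrt (K\<^sub>3 / \<kappa>) * h\<^sub>0 powr (\<tau> - \<sigma>) * (h powr (\<sigma> - real s) * Y)"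
      by (simp add: mult_ac)
    also have "\<dots> \<le> C * (h powr (\<sigma> - real s) * X) + C * (h powr (\<sigma> - real s) * Y)"
      using K M \<kappa> XY by (intro add_mono mult_right_mono) (auto simp: C_def)
    also have "\<dots> = C * h powr (\<sigma> - real s) * (X + Y)"
      by (simp add: algebra_simps)
    finally show ?thesis
      by (simp add: X_def Y_def E\<^sub>0_def E\<^sub>s_def E\<^sub>\<mu>_def e_def v_def v'_def algebra_simps)
  qed
  ultimately show ?thesis by blast
qed

end
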